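(* Let $\Psi_{G_{ab}}(x,y)$ be the number of isomorphism classes of finite abelian groups $F$ with $\#F\le x$ such that every cyclic group of prime power order occurring in the decomposition of $F$ as a direct sum of (nontrivial) cyclic groups of prime power order has order at most $y$. Then for every fixed $U>0$, as $x\to\infty$, \[ \Psi_{G_{ab}}(x,y)=(1+o(1))\Big(\prod_{r=2}^{\infty}\zeta(r)\Big)\,x\,\rho(u),\qquad u=\frac{\log x}{\log y}, \] uniformly for $y\ge2$ and $0<u\le U$.
   Context: $\zeta$ is the Riemann zeta function. Here $G_{ab}$ is the set of isomorphism classes of finite abelian groups under direct sum, with norm $|F|=\#F$ and primes the classes of $\mathbb{Z}/p^r\mathbb{Z}$ ($p$ prime, $r\ge1$); the trivial group is counted by $\Psi_{G_{ab}}(x,y)$. Dickman function: $\rho:[0,\infty)\to\mathbb{R}$ is the unique continuous function, differentiable on $(1,\infty)$, with $\rho(u)=1$ for $0\le u\le1$ and $u\rho'(u)+\rho(u-1)=0$ for $u>1$. *)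

theory Defs
  imports
    "HOL-Analysis.Analysis"
    "HOL-Number_Theory.Prime_Powers"
    "HOL-Algebra.Product_Groups"
begin

text \<open>Isomorphism classes are formed among groups whose elements are natural numbers; by
  \<open>ex_finite_ab_group_iso\<close> below every finite abelian group has such a copy.\<close>

definition finite_ab_groups :: "nat monoid set" where
  "finite_ab_groups = {G. comm_group G \<and> finite (carrier G)}"

definition ab_iso_rel :: "nat monoid rel" where
  "ab_iso_rel = {(G, H). G \<in> finite_ab_groups \<and> H \<in> finite_ab_groups \<and> G \<cong> H}"

lemma equiv_ab_iso_rel: "equiv finite_ab_groups ab_iso_rel"
proof (rule equivI)
  show "ab_iso_rel \<subseteq> finite_ab_groups \<times> finite_ab_groups"
    by (auto simp: ab_iso_rel_def)
  show "refl_on finite_ab_groups ab_iso_rel"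
    by (auto simp: refl_on_def ab_iso_rel_def finite_ab_groups_def intro: iso_refl)
  show "sym ab_iso_rel"
    by (auto simp: sym_def ab_iso_rel_def finite_ab_groups_def comm_group_def intro: group.iso_sym)
  show "trans ab_iso_rel"
    by (auto simp: trans_def ab_iso_rel_def intro: iso_trans)
qed

lemma ex_finite_ab_group_iso:
  fixes F :: "('a, 'b) monoid_scheme"
  assumes "comm_group F" and "finite (carrier F)"
  shows "\<exists>G \<in> finite_ab_groups. F \<cong> G"
proof -
  interpret F: comm_group F by fact
  obtain f :: "'a \<Rightarrow> nat" where f: "inj_on f (carrier F)"
    using finite_imp_inj_to_nat_seg[OF assms(2)] by blast
  define g where "g = inv_into (carrier F) f"
  define G :: "nat monoid" where
    "G = \<lparr>carrier = f ` carrier F, monoid.mult = (\<lambda>a b. f (g a \<otimes>\<^bsub>F\<^esub> g b)), one = f \<one>\<^bsub>F\<^esub>\<rparr>"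
  have gf [simp]: "g (f a) = a" if "a \<in> carrier F" for a
    using f that by (simp add: g_def)
  have comm: "comm_group G"
  proof (rule comm_groupI)
    fix a assume "a \<in> carrier G"
    then obtain b where b: "b \<in> carrier F" "a = f b" by (auto simp: G_def)
    then show "\<exists>c \<in> carrier G. c \<otimes>\<^bsub>G\<^esub> a = \<one>\<^bsub>G\<^esub>"
      by (intro bexI[of _ "f (inv\<^bsub>F\<^esub> b)"]) (auto simp: G_def)
  qed (auto simp: G_def F.m_ac)
  have "f \<in> iso F G"
    using f by (auto simp: iso_def hom_def bij_betw_def G_def)
  then show ?thesis
    using comm assms(2) by (auto simp: finite_ab_groups_def is_iso_def G_def)
qed

definition prime_power_decomposition :: "('a, 'b) monoid_scheme \<Rightarrow> nat list \<Rightarrow> bool" where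
  "prime_power_decomposition G qs \<longleftrightarrow>
     (\<forall>q \<in> set qs. primepow q) \<and>
     G \<cong> product_group {..<length qs} (\<lambda>i. integer_mod_group (qs ! i))"

text \<open>The decomposition is unique up to the order of the summands, so it makes no difference that
  the bound is required for some rather than for every decomposition. The trivial group has the
  decomposition \<open>[]\<close>.\<close>

definition smooth_ab_group :: "real \<Rightarrow> ('a, 'b) monoid_scheme \<Rightarrow> bool" where
  "smooth_ab_group y G \<longleftrightarrow>
     (\<exists>qs. prime_power_decomposition G qs \<and> (\<forall>q \<in> set qs. real q \<le> y))"

definition Psi_Gab :: "real \<Rightarrow> real \<Rightarrow> nat" where
  "Psi_Gab x y =
     card ({G \<in> finite_ab_groups. real (order G) \<le> x \<and> smooth_ab_group y G} // ab_iso_rel)"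

text \<open>The Riemann zeta function on the half-line \<open>s > 1\<close>, where its Dirichlet series converges.\<close>

definition zeta :: "real \<Rightarrow> real" where
  "zeta s = (\<Sum>n. 1 / real (Suc n) powr s)"

text \<open>The values at negative arguments are left unconstrained.\<close>

definition is_dickman :: "(real \<Rightarrow> real) \<Rightarrow> bool" where
  "is_dickman \<rho> \<longleftrightarrow>
     continuous_on {0..} \<rho> \<and>
     (\<forall>u>1. \<rho> differentiable (at u)) \<and>
     (\<forall>u. 0 \<le> u \<and> u \<le> 1 \<longrightarrow> \<rho> u = 1) \<and>
     (\<forall>u>1. u * deriv \<rho> u + \<rho> (u - 1) = 0)"

end

theory Submission
  imports Defs "HOL-Real_Asymp.Real_Asymp"
begin

text \<open>
  Isomorphism classes of finite abelian groups correspond to multisets of prime powers: the number of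
  solutions of \<open>m * x = 0\<close> in the sum of the cyclic groups of orders \<open>q\<^sub>1, \<dots>, q\<^sub>n\<close> is
  \<open>\<Prod> gcd m q\<^sub>i\<close>, and these numbers determine the \<open>q\<^sub>i\<close>. Without the smoothness bound,
  collecting the prime powers of exponent \<open>r\<close> into one integer \<open>n\<^sub>r\<close> turns the count into the
  number of sequences with \<open>\<Prod> n\<^sub>r ^ r \<le> x\<close>, which is asymptotic to \<open>x * \<Prod> zeta r\<close>.

  Classifying a multiset by its largest element gives Buchstab's identity
  \<open>\<Psi>(x, y) = \<Psi>(x, x) - (\<Sum> y < q \<le> x. \<Psi>(x / q, q))\<close> over prime powers \<open>q\<close>, and the theorem follows by
  induction on an integer bound for \<open>u\<close>. The sum is evaluated with weights \<open>mangoldt n / ln n\<close> by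
  Mertens' first theorem: with \<open>t = ln n / ln x\<close> it becomes a Riemann sum for the integral of
  \<open>\<rho> (1 / t - 1) / t\<close>, and by the equation for \<open>\<rho>\<close> this function is the derivative of
  \<open>\<rho> (1 / t)\<close>.
\<close>

section \<open>Groups and multisets of prime powers\<close>

text \<open>The induction step from \<open>k\<close> to \<open>k + 1\<close> works because removing
  \<open>q > y\<close> from a multiset replaces \<open>u = ln x / ln y\<close> by
  \<open>ln x / ln q - 1\<close>, which is less than \<open>u - 1\<close>. The obstacle is that the
  induction hypothesis speaks only of large first arguments, while \<open>x / q\<close> stays
  bounded for \<open>q\<close> close to \<open>x\<close>. Those \<open>q\<close> carry bounded mass
  in Mertens' theorem, which the factor \<open>1 / ln x\<close> makes negligible. The weight
  \<open>mangoldt n / ln n\<close> makes a bounded error in Mertens' theorem sufficient: after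
  division by \<open>ln x\<close> it tends to 0 on each of a fixed number of intervals. Passing from
  the weight to the indicator of prime powers costs only the proper prime powers above
  \<open>y\<close>, and bounded \<open>u\<close> forces \<open>y\<close> to infinity. Errors are
  kept in the form \<open>\<epsilon> * x\<close>, which can be summed over \<open>q\<close>; they
  become relative only at the end, because \<open>\<rho>\<close> has a positive minimum on
  \<open>[0, U]\<close>. In the count without smoothness the number of relevant exponents grows with
  \<open>x\<close>, so the limit needs a bound for the contribution of large exponents that is
  uniform in \<open>x\<close>.\<close>

lemma card_torsion_interval:
  assumes "q > 0"
  shows "card {a \<in> {0..<int q}. (int m * a) mod int q = 0} = gcd m q"
proof -
  define g where "g = gcd m q"
  have g: "g > 0" using assms by (simp add: g_def)
  obtain q' m' where q': "q = g * q'" and m': "m = g * m'"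
    unfolding g_def by (meson gcd_dvd1 gcd_dvd2 dvdE)
  have "g = g * gcd m' q'"
    using m' q' g_def by (metis gcd_mult_distrib_nat)
  hence "gcd m' q' = 1" using g by simp
  hence cop: "coprime (int m') (int q')" unfolding coprime_int_iff by (rule gcd_eq_1_imp_coprime)
  have q'0: "q' > 0" using assms q' by (cases q') auto
  \<comment> \<open>Cancelling the gcd turns the condition into divisibility by
    \<open>q' = q / g\<close>, and the interval contains \<open>g\<close> multiples of
    \<open>q'\<close>.\<close>
  have iff: "(int m * a) mod int q = 0 \<longleftrightarrow> int q' dvd a" for a
  proof -
    have "(int m * a) mod int q = 0 \<longleftrightarrow> int g * int q' dvd int g * (int m' * a)"
      by (simp add: q' m' mod_eq_0_iff_dvd mult.assoc)
    also have "\<dots> \<longleftrightarrow> int q' dvd int m' * a" using g by simp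
    also have "\<dots> \<longleftrightarrow> int q' dvd a"
      using cop by (simp add: coprime_commute coprime_dvd_mult_right_iff)
    finally show ?thesis .
  qed
  have "{a \<in> {0..<int q}. (int m * a) mod int q = 0} = (\<lambda>i. int q' * int i) ` {..<g}"
  proof (intro equalityI subsetI)
    fix a assume a: "a \<in> {a \<in> {0..<int q}. (int m * a) mod int q = 0}"
    then obtain b where b: "a = int q' * b" using iff by (auto elim: dvdE)
    with a q' q'0 have b1: "b \<ge> 0" "int q' * b < int q' * int g"
      by (auto simp: zero_le_mult_iff mult.commute)
    hence "nat b < g" using q'0 b1(1) by (simp add: mult_less_cancel_left nat_less_iff)
    with b b1 show "a \<in> (\<lambda>i. int q' * int i) ` {..<g}"
      by (intro image_eqI[of _ _ "nat b"]) auto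
  next
    fix a assume "a \<in> (\<lambda>i. int q' * int i) ` {..<g}"
    then obtain i where i: "i < g" "a = int q' * int i" by auto
    have "q' * i < q' * g" using i q'0 by simp
    hence "a < int q" using i q' by (metis mult.commute of_nat_less_iff of_nat_mult)
    moreover have "(int m * a) mod int q = 0" by (subst iff) (simp add: i)
    ultimately show "a \<in> {a \<in> {0..<int q}. (int m * a) mod int q = 0}" using i by auto
  qed
  moreover have "inj_on (\<lambda>i. int q' * int i) {..<g}" using q'0 by (auto simp: inj_on_def)
  ultimately show ?thesis by (simp add: card_image g_def)
qed

definition torsion :: "('a, 'b) monoid_scheme \<Rightarrow> nat \<Rightarrow> 'a set" where
  "torsion G m = {x \<in> carrier G. x [^]\<^bsub>G\<^esub> m = \<one>\<^bsub>G\<^esub>}"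

lemma card_torsion_iso:
  assumes "group G" "group H" "G \<cong> H"
  shows "card (torsion G m) = card (torsion H m)"
proof -
  obtain h where h: "h \<in> iso G H" using assms by (auto simp: is_iso_def)
  then have hom: "h \<in> hom G H" and bij: "bij_betw h (carrier G) (carrier H)"
    by (auto simp: iso_def)
  interpret group_hom G H h
    using assms hom by (simp add: group_hom_def group_hom_axioms_def)
  have "h ` torsion G m = torsion H m"
  proof (intro equalityI subsetI)
    fix y assume "y \<in> h ` torsion G m"
    then obtain x where x: "x \<in> carrier G" "x [^]\<^bsub>G\<^esub> m = \<one>\<^bsub>G\<^esub>" "y = h x"
      by (auto simp: torsion_def)
    then show "y \<in> torsion H m"
      by (auto simp: torsion_def hom_nat_pow[symmetric])
  next
    fix y assume y: "y \<in> torsion H m"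
    then obtain x where x: "x \<in> carrier G" "y = h x"
      using bij by (auto simp: torsion_def bij_betw_def)
    with y have "h (x [^]\<^bsub>G\<^esub> m) = h \<one>\<^bsub>G\<^esub>" by (simp add: torsion_def hom_nat_pow)
    hence "x [^]\<^bsub>G\<^esub> m = \<one>\<^bsub>G\<^esub>" using bij x by (auto simp: bij_betw_def inj_on_def)
    with x show "y \<in> h ` torsion G m" by (auto simp: torsion_def)
  qed
  moreover have "inj_on h (torsion G m)"
    using bij by (auto simp: torsion_def bij_betw_def inj_on_def)
  ultimately show ?thesis by (metis card_image)
qed

abbreviation cyclic_sum :: "nat list \<Rightarrow> (nat \<Rightarrow> int) monoid" where
  "cyclic_sum qs \<equiv> product_group {..<length qs} (\<lambda>i. integer_mod_group (qs ! i))"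

lemma pow_product_group:
  assumes "x \<in> carrier (product_group I G)"
  shows "x [^]\<^bsub>product_group I G\<^esub> (m::nat) = (\<lambda>i\<in>I. x i [^]\<^bsub>G i\<^esub> m)"
  by (induction m) (auto simp: fun_eq_iff)

text \<open>Powers in a product are taken in each coordinate, so the count factors. Zero entries are
  excluded because \<open>integer_mod_group 0\<close> is the infinite group of integers.\<close>

lemma card_torsion_cyclic_sum:
  assumes "0 \<notin> set qs"
  shows "card (torsion (cyclic_sum qs) m) = (\<Prod>q\<in>#mset qs. gcd m q)"
proof -
  have pos: "qs ! i > 0" if "i < length qs" for i
    using assms that by (metis gr0I nth_mem)
  have "torsion (cyclic_sum qs) m =
      (\<Pi>\<^sub>E i\<in>{..<length qs}. {a \<in> {0..<int (qs ! i)}. (int m * a) mod int (qs ! i) = 0})"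
    (is "?L = ?R")
  proof (intro equalityI subsetI)
    fix x assume x: "x \<in> ?L"
    hence c: "x \<in> carrier (cyclic_sum qs)" by (simp add: torsion_def)
    have e: "(\<lambda>i\<in>{..<length qs}. x i [^]\<^bsub>integer_mod_group (qs ! i)\<^esub> m)
        = (\<lambda>i\<in>{..<length qs}. 0)"
      using x pow_product_group[OF c, of m] by (simp add: torsion_def)
    have "(int m * x i) mod int (qs ! i) = 0" if "i < length qs" for i
      using fun_cong[OF e, of i] that by simp
    moreover have "x i \<in> {0..<int (qs ! i)}" if "i < length qs" for i
    proof -
      have "x i \<in> carrier (integer_mod_group (qs ! i))" using c that by (auto simp: PiE_iff)
      then show ?thesis using pos[OF that] by (auto simp: carrier_integer_mod_group)
    qed
    ultimately show "x \<in> ?R" using c by (auto simp: PiE_iff)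
  next
    fix x assume x: "x \<in> ?R"
    have c: "x \<in> carrier (cyclic_sum qs)"
      using x pos by (auto simp: PiE_iff carrier_integer_mod_group)
    show "x \<in> ?L" using x c pow_product_group[OF c, of m]
      by (auto simp: torsion_def fun_eq_iff PiE_iff)
  qed
  then have "card (torsion (cyclic_sum qs) m) = (\<Prod>i<length qs. gcd m (qs ! i))"
    using pos by (simp only: card_PiE[OF finite_lessThan]) (intro prod.cong refl card_torsion_interval, simp)
  also have "\<dots> = prod_list (map (gcd m) qs)"
    by (simp add: prod.list_conv_set_nth atLeast0LessThan)
  also have "\<dots> = (\<Prod>q\<in>#mset qs. gcd m q)"
    by (metis mset_map prod_mset_prod_list)
  finally show ?thesis .
qed

text \<open>The gcd of \<open>p ^ k\<close> and \<open>q\<close> is \<open>p\<close> raised to the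
  smaller of \<open>k\<close> and the exponent of \<open>p\<close> in \<open>q\<close>, so raising
  \<open>k\<close> gains a factor exactly while that exponent exceeds \<open>k\<close>.\<close>

lemma gcd_prime_power_Suc:
  assumes "prime (p::nat)"
  shows "gcd (p ^ Suc k) q = gcd (p ^ k) q * (if p ^ Suc k dvd q then p else 1)"
proof (cases "p ^ Suc k dvd q")
  case True
  then have "p ^ k dvd q" by (metis dvd_mult_right power_Suc)
  with True show ?thesis by (simp add: gcd_proj1_iff gcd_nat.absorb1)
next
  case False
  have "gcd (p ^ Suc k) q dvd p ^ Suc k" by simp
  then obtain j where j: "j \<le> Suc k" "gcd (p ^ Suc k) q = p ^ j"
    using divides_primepow_nat[OF assms] by blast
  with False have "j \<noteq> Suc k" by (metis gcd_dvd2)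
  with j have "p ^ j dvd p ^ k" by (auto intro: le_imp_power_dvd)
  moreover have "p ^ j dvd q" using j by (metis gcd_dvd2)
  ultimately have "gcd (p ^ Suc k) q dvd gcd (p ^ k) q" using j by simp
  moreover have "gcd (p ^ k) q dvd gcd (p ^ Suc k) q" by (simp add: dvd_mult)
  ultimately have "gcd (p ^ Suc k) q = gcd (p ^ k) q" by (rule dvd_antisym)
  with False show ?thesis by (simp only: if_False mult_1_right)
qed

lemma prod_gcd_prime_power_Suc:
  assumes "prime (p::nat)"
  shows "(\<Prod>q\<in>#M. gcd (p ^ Suc k) q) =
    (\<Prod>q\<in>#M. gcd (p ^ k) q) * p ^ size {#q \<in># M. p ^ Suc k dvd q#}"
proof (induction M)
  case (add q M)
  then show ?case
    using gcd_prime_power_Suc[OF assms, of k q]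
    by (cases "p ^ Suc k dvd q") (simp_all del: power_Suc add: power_Suc[of p "size _"])
qed auto

text \<open>A prime power divisible by \<open>p ^ k\<close> with \<open>k > 0\<close> is itself a
  power of \<open>p\<close>. Multiplicities are therefore differences of consecutive divisibility
  counts.\<close>

lemma count_primepow_via_dvd:
  assumes "prime (p::nat)" "k > 0" "\<forall>q\<in>#M. primepow q"
  shows "size {#q \<in># M. p ^ k dvd q#} = count M (p ^ k) + size {#q \<in># M. p ^ Suc k dvd q#}"
  using assms(3)
proof (induction M)
  case (add q M)
  then obtain r j where q: "prime r" "j > 0" "q = r ^ j" by (auto simp: primepow_def)
  have rp: "r = p" if "p ^ i dvd q" "i > 0" for i
    using that q assms
    by (metis dvd_power dvd_trans prime_dvd_power primes_dvd_imp_eq)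
  have p1: "p > 1" using assms(1) prime_gt_1_nat by blast
  have "(if p ^ k dvd q then 1 else 0) =
      (if q = p ^ k then 1 else 0) + (if p ^ Suc k dvd q then 1 else 0::nat)"
  proof (cases "p = r")
    case True
    have "p ^ i dvd q \<longleftrightarrow> i \<le> j" for i
      using q True p1 power_dvd_imp_le[of p i j] by (auto intro: le_imp_power_dvd)
    moreover have "q = p ^ k \<longleftrightarrow> k = j"
      unfolding q(3) True[symmetric] using power_inject_exp[OF p1] by metis
    ultimately show ?thesis by (simp del: power_Suc)
  next
    case False
    then have "\<not> p ^ k dvd q" "\<not> p ^ Suc k dvd q" using rp[of k] rp[of "Suc k"] assms(2) by blast+
    moreover from this have "q \<noteq> p ^ k" by auto
    ultimately show ?thesis by simp
  qed
  with add show ?case by (auto simp del: power_Suc split: if_splits)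
qed auto

text \<open>Passing from \<open>m = p ^ j\<close> to \<open>m = p ^ Suc j\<close> multiplies the
  product by \<open>p\<close> once for each entry divisible by \<open>p ^ Suc j\<close>. The
  products thus determine the divisibility counts, and these determine the multiplicities.\<close>

lemma primepow_mset_eqI:
  assumes M: "\<forall>q\<in>#M. primepow q" and M': "\<forall>q\<in>#M'. primepow q"
  assumes eq: "\<And>m. (\<Prod>q\<in>#M. gcd m q) = (\<Prod>q\<in>#M'. gcd m q)"
  shows "M = (M' :: nat multiset)"
proof (rule multiset_eqI)
  fix q
  show "count M q = count M' q"
  proof (cases "primepow q")
    case True
    then obtain p k where pk: "prime p" "k > 0" "q = p ^ k" by (auto simp: primepow_def)
    have p1: "p > 1" using pk(1) prime_gt_1_nat by blast
    have sz: "size {#q \<in># M. p ^ Suc j dvd q#} = size {#q \<in># M'. p ^ Suc j dvd q#}" for j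
    proof -
      have "(\<Prod>q\<in>#M. gcd (p ^ j) q) \<noteq> 0" using p1 by (auto simp: prod_mset_zero_iff)
      then have "p ^ size {#q \<in># M. p ^ Suc j dvd q#} = p ^ size {#q \<in># M'. p ^ Suc j dvd q#}"
        using prod_gcd_prime_power_Suc[OF pk(1), of j M] prod_gcd_prime_power_Suc[OF pk(1), of j M']
          eq[of "p ^ Suc j"] eq[of "p ^ j"] by simp
      then show ?thesis using p1 by (simp only: power_inject_exp)
    qed
    obtain j where j: "k = Suc j" using pk(2) by (cases k) auto
    show ?thesis
      using count_primepow_via_dvd[OF pk(1,2) M] count_primepow_via_dvd[OF pk(1,2) M']
        sz[of k] sz[of j] pk(3) j by simp
  next
    case False
    then show ?thesis using M M' by (metis count_inI)
  qed
qed

lemma prime_power_decomposition_unique: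
  assumes "group G" "group H" "G \<cong> H"
    and "prime_power_decomposition G qs" "prime_power_decomposition H rs"
  shows "mset qs = mset rs"
proof (rule primepow_mset_eqI)
  show "\<forall>q\<in>#mset qs. primepow q" "\<forall>q\<in>#mset rs. primepow q"
    using assms by (auto simp: prime_power_decomposition_def)
  then have z: "0 \<notin> set qs" "0 \<notin> set rs" by (force simp: set_mset_mset)+
  fix m
  have "card (torsion G m) = (\<Prod>q\<in>#mset qs. gcd m q)"
    using assms z card_torsion_iso[of G "cyclic_sum qs"]
    by (simp add: prime_power_decomposition_def card_torsion_cyclic_sum)
  moreover have "card (torsion H m) = (\<Prod>q\<in>#mset rs. gcd m q)"
    using assms z card_torsion_iso[of H "cyclic_sum rs"]
    by (simp add: prime_power_decomposition_def card_torsion_cyclic_sum)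
  ultimately show "(\<Prod>q\<in>#mset qs. gcd m q) = (\<Prod>q\<in>#mset rs. gcd m q)"
    using card_torsion_iso[OF assms(1-3)] by simp
qed

lemma cyclic_sum_iso:
  assumes "mset qs = mset rs"
  shows "cyclic_sum qs \<cong> cyclic_sum rs"
proof -
  have len: "length qs = length rs" using assms by (metis size_mset)
  obtain f where f: "f permutes {..<length rs}" "permute_list f rs = qs"
    using mset_eq_permutation[OF assms] by blast
  have nth: "rs ! f i = qs ! i" if "i < length qs" for i
    using f that len permute_list_nth by metis
  define g where "g = inv_into UNIV f"
  define h where "h = (\<lambda>x::nat \<Rightarrow> int. \<lambda>i\<in>{..<length rs}. x (g i))"
  define h' where "h' = (\<lambda>x::nat \<Rightarrow> int. \<lambda>i\<in>{..<length qs}. x (f i))"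
  have fi: "f i < length rs" if "i < length rs" for i
    using permutes_in_image[OF f(1), of i] that by auto
  have fi': "g i < length rs" if "i < length rs" for i
    using permutes_in_image[OF permutes_inv[OF f(1)], of i] that by (auto simp: g_def)
  have inv: "f (g i) = i" "g (f i) = i" for i
    using permutes_inverses[OF f(1)] by (auto simp: g_def)
  have nth': "qs ! g i = rs ! i" if "i < length rs" for i
    using nth[of "g i"] fi'[OF that] len inv by simp
  have "h \<in> iso (cyclic_sum qs) (cyclic_sum rs)"
  proof (rule isoI)
    show "h \<in> hom (cyclic_sum qs) (cyclic_sum rs)"
    proof (rule homI)
      fix x assume x: "x \<in> carrier (cyclic_sum qs)"
      have "x (g i) \<in> carrier (integer_mod_group (rs ! i))" if "i < length rs" for i
        using x fi'[OF that] nth'[OF that, symmetric] len by (simp add: PiE_iff)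
      then show "h x \<in> carrier (cyclic_sum rs)" by (auto simp: h_def)
    qed (use fi' nth' len in \<open>simp add: h_def fun_eq_iff\<close>)
    show "bij_betw h (carrier (cyclic_sum qs)) (carrier (cyclic_sum rs))"
    proof (rule bij_betwI[where g = h'])
      show "h \<in> carrier (cyclic_sum qs) \<rightarrow> carrier (cyclic_sum rs)"
      proof
        fix x assume x: "x \<in> carrier (cyclic_sum qs)"
        have "x (g i) \<in> carrier (integer_mod_group (rs ! i))" if "i < length rs" for i
          using x fi'[OF that] nth'[OF that, symmetric] len by (simp add: PiE_iff)
        then show "h x \<in> carrier (cyclic_sum rs)" by (auto simp: h_def)
      qed
      show "h' \<in> carrier (cyclic_sum rs) \<rightarrow> carrier (cyclic_sum qs)"
      proof
        fix x assume x: "x \<in> carrier (cyclic_sum rs)"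
        have "x (f i) \<in> carrier (integer_mod_group (qs ! i))" if "i < length qs" for i
          using x fi[of i] nth[OF that, symmetric] that len by (simp add: PiE_iff)
        then show "h' x \<in> carrier (cyclic_sum qs)" by (auto simp: h'_def)
      qed
      show "h' (h x) = x" if "x \<in> carrier (cyclic_sum qs)" for x
      proof
        fix i show "h' (h x) i = x i"
          using that fi[of i] len inv by (cases "i < length rs") (auto simp: h_def h'_def PiE_iff extensional_def)
      qed
      show "h (h' x) = x" if "x \<in> carrier (cyclic_sum rs)" for x
      proof
        fix i show "h (h' x) i = x i"
          using that fi'[of i] len inv by (cases "i < length rs") (auto simp: h_def h'_def PiE_iff extensional_def)
      qed
    qed
  qed
  then show ?thesis by (auto simp: is_iso_def)
qed

definition smooth_msets :: "real \<Rightarrow> real \<Rightarrow> nat multiset set" where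
  "smooth_msets x y = {M. (\<forall>q\<in>#M. primepow q \<and> real q \<le> y) \<and> real (prod_mset M) \<le> x}"

lemma order_prime_power_decomposition:
  assumes "group G" "prime_power_decomposition G qs"
  shows "order G = prod_mset (mset qs)"
proof -
  have pos: "qs ! i > 0" if "i < length qs" for i
    using assms that nth_mem[OF that] by (auto simp: prime_power_decomposition_def intro: primepow_gt_0_nat)
  have "order G = order (cyclic_sum qs)"
    using assms by (intro iso_same_card[unfolded order_def[symmetric]])
      (auto simp: prime_power_decomposition_def)
  also have "\<dots> = (\<Prod>i<length qs. card (carrier (integer_mod_group (qs ! i))))"
    by (simp add: order_def card_PiE)
  also have "\<dots> = (\<Prod>i<length qs. qs ! i)"
    using pos by (intro prod.cong) (auto simp: carrier_integer_mod_group)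
  also have "\<dots> = prod_mset (mset qs)"
    by (simp add: prod.list_conv_set_nth atLeast0LessThan prod_mset_prod_list)
  finally show ?thesis .
qed

lemma Psi_Gab_eq_card_smooth_msets: "Psi_Gab x y = card (smooth_msets x y)"
proof -
  define S where "S = {G \<in> finite_ab_groups. real (order G) \<le> x \<and> smooth_ab_group y G}"
  \<comment> \<open>\<open>R M\<close> involves no choice of a representative. For \<open>M\<close>
    in \<open>smooth_msets x y\<close> it is a full isomorphism class: nonempty by
    \<open>ex\<close>, and closed under isomorphism by \<open>cls\<close>. Uniqueness of the
    decomposition makes \<open>R\<close> injective there.\<close>
  define R where "R = (\<lambda>M. {G \<in> finite_ab_groups. \<exists>qs. prime_power_decomposition G qs \<and> mset qs = M})"
  have grp: "group G" if "G \<in> finite_ab_groups" for G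
    using that by (simp add: finite_ab_groups_def comm_group.axioms)
  have ex: "\<exists>qs G. mset qs = M \<and> G \<in> finite_ab_groups \<and> prime_power_decomposition G qs"
    if M: "M \<in> smooth_msets x y" for M
  proof -
    obtain qs where qs: "mset qs = M" using ex_mset by blast
    have pp: "\<forall>q\<in>set qs. primepow q" using M qs by (auto simp: smooth_msets_def)
    have pos: "qs ! i > 0" if "i < length qs" for i
      using pp that by (auto intro: primepow_gt_0_nat)
    have "comm_group (cyclic_sum qs)"
      by (rule group.group_comm_groupI) (simp_all add: add.commute)
    moreover have "finite (carrier (cyclic_sum qs))"
      using pos by (auto intro!: finite_PiE simp: carrier_integer_mod_group)
    ultimately obtain G where G: "G \<in> finite_ab_groups" "cyclic_sum qs \<cong> G"
      using ex_finite_ab_group_iso by blast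
    then have "prime_power_decomposition G qs"
      using pp group.iso_sym[OF _ G(2)] by (simp add: prime_power_decomposition_def)
    with G qs show ?thesis by blast
  qed
  have iso: "G \<cong> H" if "G \<in> R M" "H \<in> R M" for G H M
  proof -
    obtain qs rs where q: "prime_power_decomposition G qs" "prime_power_decomposition H rs"
      "mset qs = mset rs" and GH: "group G" "group H"
      using \<open>G \<in> R M\<close> \<open>H \<in> R M\<close> grp by (auto simp: R_def)
    have rs: "cyclic_sum rs \<cong> H"
      using q(2) by (intro group.iso_sym[OF GH(2)]) (simp add: prime_power_decomposition_def)
    have "G \<cong> cyclic_sum qs" using q by (simp add: prime_power_decomposition_def)
    from iso_trans[OF iso_trans[OF this cyclic_sum_iso[OF q(3)]] rs] show ?thesis .
  qed
  have cls: "ab_iso_rel `` {G} = R (mset qs)"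
    if G: "G \<in> finite_ab_groups" "prime_power_decomposition G qs" for G qs
  proof (intro equalityI subsetI)
    fix H assume "H \<in> ab_iso_rel `` {G}"
    then have H: "H \<in> finite_ab_groups" "G \<cong> H" by (auto simp: ab_iso_rel_def)
    have "H \<cong> G" by (rule group.iso_sym[OF grp[OF G(1)] H(2)])
    then have "prime_power_decomposition H qs"
      using G(2) iso_trans[of H G "cyclic_sum qs"] by (simp add: prime_power_decomposition_def)
    with H show "H \<in> R (mset qs)" by (auto simp: R_def)
  next
    fix H assume H: "H \<in> R (mset qs)"
    have "G \<in> R (mset qs)" using G by (auto simp: R_def)
    with H iso have "G \<cong> H" by blast
    with H G show "H \<in> ab_iso_rel `` {G}" by (auto simp: ab_iso_rel_def R_def)
  qed
  have "S // ab_iso_rel = R ` smooth_msets x y"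
  proof (intro equalityI subsetI)
    fix c assume "c \<in> S // ab_iso_rel"
    then obtain G where G: "G \<in> S" "c = ab_iso_rel `` {G}" by (auto simp: quotient_def)
    then obtain qs where qs: "prime_power_decomposition G qs" "\<forall>q\<in>set qs. real q \<le> y"
      by (auto simp: S_def smooth_ab_group_def)
    then have "mset qs \<in> smooth_msets x y"
      using G order_prime_power_decomposition[OF _ qs(1)] grp
      by (auto simp: S_def smooth_msets_def prime_power_decomposition_def)
    with cls[OF _ qs(1)] G show "c \<in> R ` smooth_msets x y" by (auto simp: S_def)
  next
    fix c assume "c \<in> R ` smooth_msets x y"
    then obtain M where M: "M \<in> smooth_msets x y" "c = R M" by blast
    from ex[OF M(1)] obtain qs G where G: "mset qs = M" "G \<in> finite_ab_groups"
      "prime_power_decomposition G qs" by blast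
    then have "G \<in> S"
      using M order_prime_power_decomposition[OF grp G(3)]
      by (auto simp: S_def smooth_msets_def smooth_ab_group_def)
    with cls[OF G(2,3)] M G show "c \<in> S // ab_iso_rel" by (auto simp: quotient_def)
  qed
  moreover have "inj_on R (smooth_msets x y)"
  proof (rule inj_onI)
    fix M M' assume M: "M \<in> smooth_msets x y" "M' \<in> smooth_msets x y" "R M = R M'"
    from ex[OF M(1)] obtain qs G where G: "mset qs = M" "G \<in> finite_ab_groups"
      "prime_power_decomposition G qs" by blast
    then have "G \<in> R M'" using M(3) by (auto simp: R_def)
    then obtain rs where "mset rs = M'" "prime_power_decomposition G rs" by (auto simp: R_def)
    with G show "M = M'"
      using prime_power_decomposition_unique[OF grp grp iso_refl, of G qs rs] by simp
  qed
  ultimately show ?thesis by (simp add: Psi_Gab_def S_def[symmetric] card_image)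
qed

section \<open>Mertens' first theorem\<close>

lemma card_multiples:
  assumes "d > 0"
  shows "card {m \<in> {1..n}. d dvd m} = n div d"
proof -
  have "{m \<in> {1..n}. d dvd m} = (\<lambda>i. d * i) ` {1..n div d}"
  proof (intro equalityI subsetI)
    fix m assume "m \<in> {m \<in> {1..n}. d dvd m}"
    then obtain i where i: "m = d * i" "1 \<le> m" "m \<le> n" by (auto elim: dvdE)
    then have "i * d \<le> n" by (simp add: mult.commute)
    then have "i \<le> n div d" using assms by (simp add: less_eq_div_iff_mult_less_eq)
    moreover have "1 \<le> i" using i by (cases i) auto
    ultimately show "m \<in> (\<lambda>i. d * i) ` {1..n div d}" using i by auto
  next
    fix m assume "m \<in> (\<lambda>i. d * i) ` {1..n div d}"
    then obtain i where i: "m = d * i" "1 \<le> i" "i \<le> n div d" by (elim imageE) auto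
    then have "i * d \<le> n" using assms by (simp add: less_eq_div_iff_mult_less_eq)
    moreover have "1 \<le> d * i" using i assms by (simp add: Suc_le_eq)
    ultimately show "m \<in> {m \<in> {1..n}. d dvd m}" using i by (simp add: mult.commute)
  qed
  moreover have "inj_on (\<lambda>i. d * i) {1..n div d}" using assms by (auto simp: inj_on_def)
  ultimately show ?thesis by (simp add: card_image)
qed

text \<open>Expand each \<open>ln m\<close> as the sum of \<open>mangoldt\<close> over the divisors
  of \<open>m\<close> and interchange the sums: \<open>n div d\<close> of the numbers up to
  \<open>n\<close> are multiples of \<open>d\<close>.\<close>

lemma ln_fact_eq_sum_mangoldt:
  "ln (fact n :: real) = (\<Sum>d=1..n. mangoldt d * real (n div d))"
proof -
  have "ln (fact n :: real) = (\<Sum>m=1..n. ln (real m))"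
    unfolding fact_prod of_nat_prod by (subst ln_prod) auto
  also have "\<dots> = (\<Sum>m=1..n. \<Sum>d | d dvd m. mangoldt d)"
    by (intro sum.cong refl) (simp add: mangoldt_sum)
  also have "\<dots> = (\<Sum>m=1..n. \<Sum>d=1..n. if d dvd m then mangoldt d else 0)"
  proof (rule sum.cong[OF refl])
    fix m assume m: "m \<in> {1..n}"
    then have "{d \<in> {1..n}. d dvd m} = {d. d dvd m}"
      by (auto dest: dvd_imp_le intro: Nat.gr0I)
    then show "(\<Sum>d | d dvd m. mangoldt d) = (\<Sum>d=1..n. if d dvd m then mangoldt d else (0::real))"
      by (simp add: sum.inter_filter[symmetric])
  qed
  also have "\<dots> = (\<Sum>d=1..n. \<Sum>m=1..n. if d dvd m then mangoldt d else 0)"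
    by (rule sum.swap)
  also have "\<dots> = (\<Sum>d=1..n. mangoldt d * real (n div d))"
  proof (rule sum.cong[OF refl])
    fix d assume "d \<in> {1..n}"
    then show "(\<Sum>m=1..n. if d dvd m then mangoldt d else 0) = mangoldt d * real (n div d)"
      using card_multiples[of d n] by (simp add: sum.inter_filter[symmetric])
  qed
  finally show ?thesis .
qed

text \<open>The central binomial coefficient is at most \<open>4 ^ n\<close>. In its logarithm
  \<open>mangoldt d\<close> has the coefficient \<open>2 * n div d - 2 * (n div d)\<close>, which is
  never negative and equals 1 for \<open>n < d \<le> 2 * n\<close>.\<close>

lemma chebyshev_psi_double:
  "(\<Sum>d=1..2*n. mangoldt d) - (\<Sum>d=1..n. mangoldt d) \<le> 2 * real n * ln 2"
proof -
  have "real (2 * n choose n) \<le> real (\<Sum>k\<le>2*n. 2 * n choose k)"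
    by (intro of_nat_mono member_le_sum) auto
  also have "\<dots> = 2 ^ (2 * n)" by (simp add: choose_row_sum)
  finally have "ln (real (2 * n choose n)) \<le> ln (2 ^ (2 * n))" by simp
  then have "ln (real (2 * n choose n)) \<le> 2 * real n * ln 2" by (simp add: ln_realpow)
  moreover have "ln (real (2 * n choose n)) = ln (fact (2 * n)) - 2 * ln (fact n :: real)"
    by (simp add: binomial_fact ln_div ln_mult)
  moreover have "ln (fact (2 * n)) - 2 * ln (fact n :: real)
      = (\<Sum>d=1..2*n. mangoldt d * (real (2 * n div d) - 2 * real (n div d)))"
  proof -
    have "(\<Sum>d=1..n. mangoldt d * real (n div d)) = (\<Sum>d=1..2*n. mangoldt d * real (n div d))"
      by (intro sum.mono_neutral_left) auto
    then show ?thesis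
      by (simp add: ln_fact_eq_sum_mangoldt right_diff_distrib sum_subtractf sum_distrib_left mult_ac)
  qed
  moreover have "(\<Sum>d=1..2*n. mangoldt d * (real (2 * n div d) - 2 * real (n div d)))
      \<ge> (\<Sum>d=1..2*n. if d \<in> {n+1..2*n} then mangoldt d else 0)"
  proof (intro sum_mono)
    fix d assume d: "d \<in> {1..2*n}"
    show "(if d \<in> {n+1..2*n} then mangoldt d else 0)
        \<le> mangoldt d * (real (2 * n div d) - 2 * real (n div d))"
    proof (cases "d \<le> n")
      case True
      have "2 * (n div d) \<le> 2 * n div d"
        using d by (simp add: less_eq_div_iff_mult_less_eq)
      then have "2 * real (n div d) \<le> real (2 * n div d)" by linarith
      then show ?thesis using True mangoldt_nonneg[of d] by simp
    next
      case False
      then have "n div d = 0" "2 * n div d = 1" using d by (auto simp: div_nat_eqI)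
      then show ?thesis using mangoldt_nonneg[of d] by simp
    qed
  qed
  moreover have "(\<Sum>d=1..2*n. if d \<in> {n+1..2*n} then mangoldt d else 0)
      = (\<Sum>d=1..2*n. mangoldt d) - (\<Sum>d=1..n. mangoldt d :: real)"
  proof -
    have "(\<Sum>d=1..2*n. if d \<in> {n+1..2*n} then mangoldt d else 0)
        = (\<Sum>d\<in>{1..2*n} \<inter> {n+1..2*n}. mangoldt d :: real)" by (rule sum.inter_restrict[symmetric]) auto
    also have "{1..2*n} \<inter> {n+1..2*n} = {1..2*n} - {1..n}" by auto
    also have "(\<Sum>d\<in>\<dots>. mangoldt d :: real) = (\<Sum>d=1..2*n. mangoldt d) - (\<Sum>d=1..n. mangoldt d)"
      by (intro sum_diff) auto
    finally show ?thesis .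
  qed
  ultimately show ?thesis by linarith
qed

lemma chebyshev_psi_le: "(\<Sum>d=1..n. mangoldt d) \<le> 4 * real n * ln 2"
proof (induction n rule: less_induct)
  case (less n)
  consider "n = 0" | "n = 1" | "n = 2" | "n \<ge> 3" by linarith
  then show ?case
  proof cases
    case 3
    have "{1..2::nat} = {1, 2}" by auto
    then show ?thesis using 3 by (simp add: mangoldt_prime[of 2, simplified])
  next
    case 4
    \<comment> \<open>Rounding up loses a little: the bound obtained is
      \<open>6 * m \<le> 3 * (n + 1)\<close>, which is at most \<open>4 * n\<close> only from
      \<open>n = 3\<close> on. This explains both the constant 4 and the separate small
      cases.\<close>
    define m where "m = (n + 1) div 2"
    have m: "m < n" "n \<le> 2 * m" "2 * m \<le> n + 1" using 4 by (auto simp: m_def)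
    have "(\<Sum>d=1..n. mangoldt d) \<le> (\<Sum>d=1..2*m. mangoldt d :: real)"
      using m by (intro sum_mono2) (auto simp: mangoldt_nonneg)
    also have "\<dots> \<le> (\<Sum>d=1..m. mangoldt d) + 2 * real m * ln 2"
      using chebyshev_psi_double[of m] by simp
    also have "\<dots> \<le> 6 * real m * ln 2" using less[OF m(1)] by simp
    also have "\<dots> \<le> 4 * real n * ln 2" using m 4 by (intro mult_right_mono) auto
    finally show ?thesis .
  qed auto
qed

text \<open>Weak Stirling: the left side grows by at most \<open>ln (n + 1)\<close> from
  \<open>n\<close> to \<open>n + 1\<close>, because
  \<open>n * (ln (n + 1) - ln n) \<le> 1\<close>.\<close>

lemma ln_fact_ge: "real n * ln (real n) - real n \<le> ln (fact n)"
proof (induction n)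
  case (Suc n)
  show ?case
  proof (cases "n = 0")
    case False
    have "1 + 1 / real n = real (Suc n) / real n" using False by (simp add: field_simps)
    then have "ln (real (Suc n)) - ln (real n) = ln (1 + 1 / real n)"
      using False by (simp add: ln_div del: of_nat_Suc)
    also have "\<dots> \<le> 1 / real n" by (intro ln_add_one_self_le_self) simp
    finally have "real n * (ln (real (Suc n)) - ln (real n)) \<le> 1"
      using False by (simp add: field_simps)
    moreover have "ln (fact (Suc n) :: real) = ln (real (Suc n)) + ln (fact n)"
      by (simp add: ln_mult del: of_nat_Suc)
    ultimately show ?thesis using Suc.IH by (simp add: algebra_simps)
  qed auto
qed auto

lemma ln_fact_le: "ln (fact n) \<le> real n * ln (real n)"
proof (cases "n = 0")
  case False
  have "fact n \<le> (real n) ^ n" by (metis fact_le_power of_nat_fact of_nat_le_iff of_nat_power order_refl)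
  then have "ln (fact n) \<le> ln (real n ^ n)" using False by (subst ln_le_cancel_iff) auto
  with False show ?thesis by (simp add: ln_realpow)
qed auto

text \<open>Multiply the sum by \<open>n\<close> and compare with \<open>ln (fact n)\<close>.
  Replacing \<open>n div d\<close> by \<open>n / d\<close> costs at most the sum of
  \<open>mangoldt\<close>, that is \<open>4 * n * ln 2 \<le> 4 * n\<close>; in the other direction
  only the loss \<open>n\<close> of the Stirling bound occurs.\<close>

lemma mertens_first_nat:
  assumes "n > 0"
  shows "\<bar>(\<Sum>d=1..n. mangoldt d / real d) - ln (real n)\<bar> \<le> 4"
proof -
  let ?S = "\<Sum>d=1..n. mangoldt d / real d :: real"
  have nS: "real n * ?S = (\<Sum>d=1..n. mangoldt d * (real n / real d))"
    by (simp add: sum_distrib_left mult_ac)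
  have "ln (fact n) \<le> real n * ?S"
    unfolding ln_fact_eq_sum_mangoldt nS
    by (intro sum_mono mult_left_mono of_nat_div_le_of_nat mangoldt_nonneg)
  with ln_fact_ge[of n] have "real n * (ln (real n) - 1) \<le> real n * ?S" by (simp add: algebra_simps)
  then have 1: "ln (real n) - 1 \<le> ?S" using assms by simp
  have "real n * ?S \<le> (\<Sum>d=1..n. mangoldt d * (real (n div d) + 1))"
    unfolding nS
  proof (intro sum_mono mult_left_mono mangoldt_nonneg)
    fix d assume d: "d \<in> {1..n}"
    have "n \<le> d * (n div d + 1)" using d dividend_less_times_div[of d n] by (simp add: less_imp_le)
    then have "real n \<le> real d * (real (n div d) + 1)" by (metis of_nat_1 of_nat_add of_nat_le_iff of_nat_mult)
    then show "real n / real d \<le> real (n div d) + 1" using d by (simp add: divide_le_eq mult.commute)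
  qed
  also have "\<dots> = ln (fact n) + (\<Sum>d=1..n. mangoldt d)"
    by (simp add: ln_fact_eq_sum_mangoldt algebra_simps sum.distrib)
  also have "\<dots> \<le> real n * ln (real n) + 4 * real n * ln 2"
    by (intro add_mono ln_fact_le chebyshev_psi_le)
  also have "\<dots> \<le> real n * (ln (real n) + 4)"
    using ln_le_minus_one[of "2::real"] assms by (simp add: algebra_simps)
  finally have "?S \<le> ln (real n) + 4" using assms by simp
  with 1 show ?thesis by linarith
qed

text \<open>Open on the left, so that adjacent intervals concatenate without overlap; the endpoints
  are real because they will be powers \<open>x powr t\<close>.\<close>

definition nats_between :: "real \<Rightarrow> real \<Rightarrow> nat set" where
  "nats_between a b = {n. a < real n \<and> real n \<le> b}"

lemma finite_nats_between [simp, intro]: "finite (nats_between a b)"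
proof (rule finite_subset)
  show "nats_between a b \<subseteq> {..nat \<lfloor>b\<rfloor>}" by (auto simp: nats_between_def le_nat_floor)
qed auto

text \<open>Each endpoint contributes 4 from the integer version and at most
  \<open>ln 2 \<le> 1\<close> from rounding down, so 10 is twice 5.\<close>

lemma mertens_first:
  assumes "1 \<le> a" "a \<le> b"
  shows "\<bar>(\<Sum>n\<in>nats_between a b. mangoldt n / real n) - (ln b - ln a)\<bar> \<le> 10"
proof -
  have ln_floor: "0 < nat \<lfloor>x\<rfloor>" "\<bar>ln x - ln (real (nat \<lfloor>x\<rfloor>))\<bar> \<le> 1" if "1 \<le> x" for x :: real
  proof -
    define N where "N = nat \<lfloor>x\<rfloor>"
    have f1: "1 \<le> \<lfloor>x\<rfloor>" using that by (simp add: le_floor_iff)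
    then have 0: "0 < N" unfolding N_def by linarith
    have "real N = of_int \<lfloor>x\<rfloor>" using f1 by (simp add: N_def)
    moreover have "of_int \<lfloor>x\<rfloor> \<ge> (1::real)" using f1 by simp
    ultimately have 1: "real N \<le> x" "x \<le> 2 * real N" by linarith+
    have "ln (real N) \<le> ln x" using 0 1 that by simp
    moreover have "ln x \<le> ln (2 * real N)" using 0 1 that by (subst ln_le_cancel_iff) auto
    moreover have "ln (2 * real N) = ln 2 + ln (real N)" using 0 by (simp add: ln_mult)
    moreover have "ln 2 \<le> (1::real)" using ln_le_minus_one[of "2::real"] by simp
    ultimately have "\<bar>ln x - ln (real N)\<bar> \<le> 1" by linarith
    with 0 show "0 < nat \<lfloor>x\<rfloor>" "\<bar>ln x - ln (real (nat \<lfloor>x\<rfloor>))\<bar> \<le> 1" by (simp_all only: N_def)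
  qed
  have eq: "nats_between a b = {1..nat \<lfloor>b\<rfloor>} - {1..nat \<lfloor>a\<rfloor>}"
  proof (rule Set.set_eqI)
    fix n
    have "a < real n \<longleftrightarrow> \<not> n \<le> nat \<lfloor>a\<rfloor>" "real n \<le> b \<longleftrightarrow> n \<le> nat \<lfloor>b\<rfloor>"
      using assms by (auto simp: le_nat_iff le_floor_iff not_le)
    moreover have "a < real n \<Longrightarrow> 1 \<le> n" using assms by linarith
    ultimately show "n \<in> nats_between a b \<longleftrightarrow> n \<in> {1..nat \<lfloor>b\<rfloor>} - {1..nat \<lfloor>a\<rfloor>}"
      by (auto simp: nats_between_def)
  qed
  have "nat \<lfloor>a\<rfloor> \<le> nat \<lfloor>b\<rfloor>" using assms by (intro nat_mono floor_mono)
  then have "(\<Sum>n\<in>nats_between a b. mangoldt n / real n)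
      = (\<Sum>n=1..nat \<lfloor>b\<rfloor>. mangoldt n / real n) - (\<Sum>n=1..nat \<lfloor>a\<rfloor>. mangoldt n / real n :: real)"
    unfolding eq by (intro sum_diff) auto
  then show ?thesis
    using ln_floor[of a] ln_floor[of b] mertens_first_nat[of "nat \<lfloor>a\<rfloor>"] mertens_first_nat[of "nat \<lfloor>b\<rfloor>"] assms
    by linarith
qed

section \<open>Reciprocals of prime powers with exponent at least 2\<close>

lemma sum_power_le:
  fixes x :: real
  assumes "0 \<le> x" "x < 1"
  shows "(\<Sum>k=2..N. x ^ k) \<le> x\<^sup>2 / (1 - x)"
proof (cases "N \<ge> 1")
  case True
  then have "(\<Sum>k=2..N. x ^ k) + x ^ Suc N / (1 - x) = x\<^sup>2 / (1 - x)"
  proof (induction N rule: dec_induct)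
    case (step n)
    have "x ^ Suc n + x ^ Suc (Suc n) / (1 - x) = x ^ Suc n / (1 - x)"
      using assms by (simp add: field_simps)
    with step show ?case by simp
  qed (simp add: power2_eq_square)
  moreover have "x ^ Suc N / (1 - x) \<ge> 0" using assms by simp
  ultimately show ?thesis by linarith
qed (use assms in auto)

definition proper_primepows :: "nat set" where
  "proper_primepows = {q. primepow q \<and> \<not> prime q}"

text \<open>Let the base \<open>p\<close> run over all integers from 2 on. The sum over exponents
  from 2 on is then at most \<open>1 / (p - 1) - 1 / p\<close>, and this telescopes.\<close>

lemma sum_inverse_proper_primepows_le:
  assumes "finite F" "F \<subseteq> proper_primepows"
  shows "(\<Sum>q\<in>F. 1 / real q) \<le> 1"
proof -
  obtain N where N: "N \<ge> 2" "\<And>q. q \<in> F \<Longrightarrow> q < N"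
  proof (rule that)
    have "2 \<le> Max (insert 2 F)" using assms(1) by (intro Max_ge) auto
    then show "Max (insert 2 F) + 1 \<ge> 2" by linarith
    show "q < Max (insert 2 F) + 1" if "q \<in> F" for q
      using assms(1) that Max_ge[of "insert 2 F" q] by (simp add: less_Suc_eq_le)
  qed
  have "F \<subseteq> (\<lambda>(p, k). p ^ k) ` ({2..N} \<times> {2..N})"
  proof
    fix q assume q: "q \<in> F"
    then obtain p k where pk: "prime p" "k > 0" "q = p ^ k" "\<not> prime q"
      using assms(2) by (auto simp: proper_primepows_def primepow_def)
    then have "k \<noteq> 1" by auto
    moreover have p: "p \<ge> 2" using pk(1) prime_ge_2_nat by blast
    moreover have "p ^ 1 \<le> p ^ k" using pk p by (intro power_increasing) auto
    moreover have "k < p ^ k" using p by (metis less_exp order_less_le_trans power_mono zero_le_numeral)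
    ultimately show "q \<in> (\<lambda>(p, k). p ^ k) ` ({2..N} \<times> {2..N})"
      using pk N(2)[OF q] by (intro image_eqI[of _ _ "(p, k)"]) auto
  qed
  then have "(\<Sum>q\<in>F. 1 / real q) \<le> (\<Sum>q\<in>(\<lambda>(p, k). p ^ k) ` ({2..N} \<times> {2..N}). 1 / real q)"
    by (intro sum_mono2) auto
  also have "\<dots> \<le> (\<Sum>(p, k)\<in>{2..N} \<times> {2..N}. 1 / real (p ^ k))"
    by (rule order_trans[OF sum_image_le]) (auto simp: case_prod_unfold)
  also have "\<dots> = (\<Sum>p=2..N. \<Sum>k=2..N. (1 / real p) ^ k)"
    by (simp add: sum.cartesian_product power_one_over)
  also have "\<dots> \<le> (\<Sum>p=2..N. 1 / (real p - 1) - 1 / real p)"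
  proof (intro sum_mono)
    fix p assume p: "p \<in> {2..N}"
    have "(\<Sum>k=2..N. (1 / real p) ^ k) \<le> (1 / real p)\<^sup>2 / (1 - 1 / real p)"
      using p by (intro sum_power_le) auto
    also have "\<dots> = 1 / (real p - 1) - 1 / real p"
      using p by (simp add: field_simps power2_eq_square)
    finally show "(\<Sum>k=2..N. (1 / real p) ^ k) \<le> 1 / (real p - 1) - 1 / real p" .
  qed
  also have "\<dots> = 1 - 1 / real N"
    using N(1) by (induction N rule: dec_induct) auto
  finally show ?thesis by (smt (verit) divide_nonneg_nonneg of_nat_0_le_iff)
qed

text \<open>Choose a finite \<open>F0\<close> whose sum is within \<epsilon> of the supremum of all
  finite sums. A finite set beyond the maximum of \<open>F0\<close> is disjoint from it, and adding
  its sum cannot pass the supremum.\<close>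

lemma proper_primepows_tail:
  assumes "\<epsilon> > 0"
  obtains Y :: real where "\<And>F. finite F \<Longrightarrow> F \<subseteq> proper_primepows \<Longrightarrow> (\<forall>q\<in>F. real q > Y)
    \<Longrightarrow> (\<Sum>q\<in>F. 1 / real q) \<le> \<epsilon>"
proof -
  define S where "S = (\<lambda>F. \<Sum>q\<in>F. 1 / real q)"
  define X where "X = S ` {F. finite F \<and> F \<subseteq> proper_primepows}"
  have bdd: "bdd_above X"
    unfolding X_def S_def using sum_inverse_proper_primepows_le by (intro bdd_aboveI[of _ 1]) blast
  have ne: "X \<noteq> {}" by (auto simp: X_def)
  have "Sup X - \<epsilon> < Sup X" using assms by simp
  then have "\<exists>s\<in>X. Sup X - \<epsilon> < s" by (rule less_cSup_iff[OF ne bdd, THEN iffD1])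
  then obtain F0 where F0: "finite F0" "F0 \<subseteq> proper_primepows" "Sup X - \<epsilon> < S F0"
    by (auto simp: X_def)
  show ?thesis
  proof (rule that[of "real (Max (insert 0 F0))"])
    fix F assume F: "finite F" "F \<subseteq> proper_primepows" "\<forall>q\<in>F. real q > real (Max (insert 0 F0))"
    have "q \<notin> F0" if "q \<in> F" for q
    proof
      assume "q \<in> F0"
      then have "q \<le> Max (insert 0 F0)" using F0(1) by (intro Max_ge) auto
      with F(3) that show False by force
    qed
    then have "F \<inter> F0 = {}" by blast
    then have "S (F \<union> F0) = S F + S F0" using F F0 by (simp add: S_def sum.union_disjoint)
    moreover have "S (F \<union> F0) \<le> Sup X" using F F0 by (intro cSup_upper bdd) (auto simp: X_def)
    ultimately show "(\<Sum>q\<in>F. 1 / real q) \<le> \<epsilon>" using F0(3) by (simp add: S_def)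
  qed
qed

section \<open>The number of abelian groups\<close>

lemma prod_mset_ge_two_power:
  fixes M :: "nat multiset"
  assumes "\<forall>q\<in>#M. 2 \<le> q"
  shows "2 ^ size M \<le> prod_mset M"
  using assms by (induction M) (auto intro!: mult_mono)

lemma mem_le_prod_mset:
  fixes M :: "nat multiset"
  assumes "\<forall>q\<in>#M. 2 \<le> q" "q \<in># M"
  shows "q \<le> prod_mset M"
proof (rule dvd_imp_le)
  show "q dvd prod_mset M" using assms(2) by (rule dvd_prod_mset)
  show "0 < prod_mset M"
    using prod_mset_ge_two_power[OF assms(1)] by (meson less_le_trans zero_less_numeral zero_less_power)
qed

lemma finite_msets_prod_le:
  "finite {M :: nat multiset. (\<forall>q\<in>#M. 2 \<le> q) \<and> real (prod_mset M) \<le> x}"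
proof (rule finite_subset)
  define n where "n = nat \<lfloor>x\<rfloor>"
  show "{M :: nat multiset. (\<forall>q\<in>#M. 2 \<le> q) \<and> real (prod_mset M) \<le> x}
      \<subseteq> mset ` {xs. set xs \<subseteq> {..n} \<and> length xs \<le> n}"
  proof
    fix M :: "nat multiset"
    assume "M \<in> {M :: nat multiset. (\<forall>q\<in>#M. 2 \<le> q) \<and> real (prod_mset M) \<le> x}"
    then have M: "\<forall>q\<in>#M. 2 \<le> q" "prod_mset M \<le> n" by (auto simp: n_def le_nat_floor)
    obtain xs where xs: "mset xs = M" using ex_mset by blast
    have "size M < 2 ^ size M" by simp
    also have "\<dots> \<le> n" using prod_mset_ge_two_power[OF M(1)] M(2) by linarith
    finally have "length xs \<le> n" using xs by (metis less_imp_le size_mset)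
    moreover have "set xs \<subseteq> {..n}"
      using mem_le_prod_mset[OF M(1)] M(2) xs by (metis atMost_iff order_trans set_mset_mset subsetI)
    ultimately show "M \<in> mset ` {xs. set xs \<subseteq> {..n} \<and> length xs \<le> n}" using xs by blast
  qed
qed (simp add: finite_lists_length_le)

lemma primepow_ge_two: "primepow q \<Longrightarrow> 2 \<le> (q::nat)"
  using primepow_gt_Suc_0[of q] by simp

lemma finite_smooth_msets [simp]: "finite (smooth_msets x y)"
  by (rule finite_subset[OF _ finite_msets_prod_le[of x]]) (auto simp: smooth_msets_def primepow_ge_two)

definition exponent :: "nat \<Rightarrow> nat" where
  "exponent q = multiplicity (aprimedivisor q) q"

lemma exponent_prime_power: "prime p \<Longrightarrow> k > 0 \<Longrightarrow> exponent (p ^ k) = k"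
  by (simp add: exponent_def aprimedivisor_prime_power)

lemma primepow_exponentE:
  assumes "primepow (q::nat)"
  obtains p where "prime p" "q = p ^ exponent q" "exponent q > 0" "aprimedivisor q = p"
proof -
  obtain p k where "prime p" "k > 0" "q = p ^ k" using assms by (auto simp: primepow_def)
  then show ?thesis using that[of p] by (simp add: exponent_prime_power aprimedivisor_prime_power)
qed

text \<open>The exponent bound interpolates between the empty multiset alone (\<open>R = 0\<close>)
  and all multisets (\<open>2 ^ Suc R > x\<close>); each increase of \<open>R\<close> brings in one
  new integer variable.\<close>

definition bounded_msets :: "nat \<Rightarrow> real \<Rightarrow> nat multiset set" where
  "bounded_msets R x = {M. (\<forall>q\<in>#M. primepow q \<and> exponent q \<le> R) \<and> real (prod_mset M) \<le> x}"

lemma finite_bounded_msets [simp]: "finite (bounded_msets R x)"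
  by (rule finite_subset[OF _ finite_msets_prod_le[of x]]) (auto simp: bounded_msets_def primepow_ge_two)

lemma bounded_msets_empty:
  assumes "x < 1" shows "bounded_msets R x = {}"
proof -
  have False if "M \<in> bounded_msets R x" for M
  proof -
    have "\<forall>q\<in>#M. 2 \<le> q" using that primepow_ge_two by (auto simp: bounded_msets_def)
    then have "2 ^ size M \<le> prod_mset M" by (rule prod_mset_ge_two_power)
    then have "1 \<le> prod_mset M" by (meson le_trans one_le_numeral one_le_power)
    then show False using that assms by (auto simp: bounded_msets_def)
  qed
  then show ?thesis by blast
qed

lemma prod_mset_image_power:
  "prod_mset (image_mset (\<lambda>p. p ^ s) P) = prod_mset P ^ s" for P :: "nat multiset"
  by (induction P) (auto simp: power_mult_distrib)

text \<open>The entries of exponent \<open>Suc R\<close> are powers \<open>p ^ Suc R\<close>. By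
  unique factorization their bases form the prime factorization of an arbitrary
  \<open>n \<ge> 1\<close>, and together they contribute \<open>n ^ Suc R\<close> to the
  product.\<close>

lemma bij_betw_bounded_msets_Suc:
  "bij_betw (\<lambda>(n, M). M + image_mset (\<lambda>p. p ^ Suc R) (prime_factorization n))
     (SIGMA n:{n. 1 \<le> n \<and> real n ^ Suc R \<le> x}. bounded_msets R (x / real n ^ Suc R))
     (bounded_msets (Suc R) x)"
proof (rule bij_betwI[where g = "\<lambda>M.
      (prod_mset (image_mset aprimedivisor (filter_mset (\<lambda>q. \<not> exponent q \<le> R) M)),
       filter_mset (\<lambda>q. exponent q \<le> R) M)"])
  let ?S = "SIGMA n:{n. 1 \<le> n \<and> real n ^ Suc R \<le> x}. bounded_msets R (x / real n ^ Suc R)"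
  let ?f = "\<lambda>(n, M). M + image_mset (\<lambda>p. p ^ Suc R) (prime_factorization n)"
  let ?P = "\<lambda>M. image_mset aprimedivisor (filter_mset (\<lambda>q. \<not> exponent q \<le> R) M)"
  let ?g = "\<lambda>M. (prod_mset (?P M), filter_mset (\<lambda>q. exponent q \<le> R) M)"
  have prod_img: "prod_mset (image_mset (\<lambda>p. p ^ Suc R) (prime_factorization n)) = n ^ Suc R"
    if "1 \<le> n" for n :: nat
    unfolding prod_mset_image_power using that by (subst prod_mset_prime_factorization_nat) auto
  have P: "image_mset (\<lambda>p. p ^ Suc R) (?P M) = filter_mset (\<lambda>q. \<not> exponent q \<le> R) M"
    "\<forall>p\<in>#?P M. prime p"
    if M: "M \<in> bounded_msets (Suc R) x" for M
  proof -
    have *: "aprimedivisor q ^ Suc R = q \<and> prime (aprimedivisor q)"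
      if q: "q \<in># filter_mset (\<lambda>q. \<not> exponent q \<le> R) M" for q
    proof -
      have "primepow q" "exponent q = Suc R" using M q by (auto simp: bounded_msets_def)
      then show ?thesis by (metis primepow_exponentE)
    qed
    show "image_mset (\<lambda>p. p ^ Suc R) (?P M) = filter_mset (\<lambda>q. \<not> exponent q \<le> R) M"
      unfolding image_mset.compositionality o_def using * by (subst image_mset_cong[of _ _ id]) auto
    show "\<forall>p\<in>#?P M. prime p" using * by auto
  qed
  show "?f \<in> ?S \<rightarrow> bounded_msets (Suc R) x"
  proof (rule Pi_I, clarify)
    fix n M assume n: "1 \<le> n" and M: "M \<in> bounded_msets R (x / real n ^ Suc R)"
    have "real (prod_mset M) * real n ^ Suc R \<le> x"
      using M n by (simp add: bounded_msets_def field_simps)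
    then have "real (prod_mset (?f (n, M))) \<le> x"
      using prod_img[OF n] by simp
    moreover have "primepow q \<and> exponent q \<le> Suc R" if "q \<in># ?f (n, M)" for q
    proof -
      have "q \<in># M \<or> (\<exists>p\<in>#prime_factorization n. q = p ^ Suc R)" using that by auto
      then show ?thesis
      proof
        assume "\<exists>p\<in>#prime_factorization n. q = p ^ Suc R"
        then obtain p where "prime p" "q = p ^ Suc R" by auto
        then show ?thesis by (simp add: exponent_prime_power primepow_prime_power del: power_Suc)
      qed (use M in \<open>auto simp: bounded_msets_def\<close>)
    qed
    ultimately show "M + image_mset (\<lambda>p. p ^ Suc R) (prime_factorization n) \<in> bounded_msets (Suc R) x"
      by (simp add: bounded_msets_def)
  qed
  show "?g \<in> bounded_msets (Suc R) x \<rightarrow> ?S"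
  proof (rule Pi_I)
    fix M assume M: "M \<in> bounded_msets (Suc R) x"
    define n M' where "n = prod_mset (?P M)" and "M' = filter_mset (\<lambda>q. exponent q \<le> R) M"
    have "M = M' + image_mset (\<lambda>p. p ^ Suc R) (?P M)"
      unfolding P(1)[OF M] M'_def by simp
    then have "prod_mset M = prod_mset M' * n ^ Suc R"
      unfolding n_def prod_mset_image_power[symmetric] by (metis prod_mset_Un)
    then have pr: "real (prod_mset M') * real n ^ Suc R \<le> x"
      using M by (simp add: bounded_msets_def)
    have "1 \<le> n"
      using P(2)[OF M] unfolding n_def by (metis One_nat_def Suc_leI gr0I not_prime_0 prod_mset_zero_iff)
    have "\<forall>q\<in>#M'. 2 \<le> q" using M primepow_ge_two by (auto simp: M'_def bounded_msets_def)
    then have "2 ^ size M' \<le> prod_mset M'" by (rule prod_mset_ge_two_power)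
    then have "1 \<le> prod_mset M'" by (meson le_trans one_le_numeral one_le_power)
    then have "1 * real n ^ Suc R \<le> real (prod_mset M') * real n ^ Suc R"
      by (intro mult_right_mono) auto
    then have "real n ^ Suc R \<le> x" using pr by simp
    moreover have "M' \<in> bounded_msets R (x / real n ^ Suc R)"
      using M pr \<open>1 \<le> n\<close> by (auto simp: bounded_msets_def M'_def field_simps)
    ultimately show "?g M \<in> ?S" using \<open>1 \<le> n\<close> by (simp add: n_def M'_def)
  qed
  show "?g (?f z) = z" if "z \<in> ?S" for z
  proof -
    obtain n M where z: "z = (n, M)" by (cases z)
    have n: "1 \<le> n" and M: "M \<in> bounded_msets R (x / real n ^ Suc R)" using that z by auto
    have e: "exponent (p ^ Suc R) = Suc R" "aprimedivisor (p ^ Suc R) = p"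
      if "p \<in># prime_factorization n" for p
    proof -
      have "prime p" using that by auto
      then show "exponent (p ^ Suc R) = Suc R" "aprimedivisor (p ^ Suc R) = p"
        by (simp_all add: exponent_prime_power aprimedivisor_prime_power del: power_Suc)
    qed
    let ?I = "image_mset (\<lambda>p. p ^ Suc R) (prime_factorization n)"
    have M1: "filter_mset (\<lambda>q. exponent q \<le> R) M = M"
      and M2: "filter_mset (\<lambda>q. \<not> exponent q \<le> R) M = {#}"
      using M by (auto simp: bounded_msets_def filter_mset_eq_conv)
    have I1: "filter_mset (\<lambda>q. exponent q \<le> R) ?I = {#}"
      and I2: "filter_mset (\<lambda>q. \<not> exponent q \<le> R) ?I = ?I"
      using e by (auto simp: filter_mset_eq_conv simp del: power_Suc)
    have "image_mset aprimedivisor ?I = prime_factorization n"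
      unfolding image_mset.compositionality o_def
      using e(2) by (subst image_mset_cong[of _ _ id]) (auto simp del: power_Suc)
    moreover have "prod_mset (prime_factorization n) = n"
      using n by (intro prod_mset_prime_factorization_nat) simp
    ultimately show ?thesis
      by (simp only: z case_prod_conv filter_union_mset M1 M2 I1 I2 empty_neutral)
  qed
  show "?f (?g M) = M" if M: "M \<in> bounded_msets (Suc R) x" for M
  proof -
    have "prime_factorization (prod_mset (?P M)) = ?P M"
      using P(2)[OF M] by (intro prime_factorization_prod_mset_primes) auto
    then show ?thesis by (simp only: case_prod_conv P(1)[OF M]) simp
  qed
qed

lemma finite_nat_power_le: "finite {n::nat. 1 \<le> n \<and> real n ^ Suc R \<le> x}"
proof (rule finite_subset)
  show "{n::nat. 1 \<le> n \<and> real n ^ Suc R \<le> x} \<subseteq> {..nat \<lfloor>x\<rfloor>}"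
  proof clarify
    fix n :: nat assume n: "1 \<le> n" "real n ^ Suc R \<le> x"
    have "real n \<le> real n ^ Suc R" using n(1) by (intro self_le_power) auto
    with n(2) show "n \<le> nat \<lfloor>x\<rfloor>" by (intro le_nat_floor) linarith
  qed
qed auto

lemma card_bounded_msets_Suc:
  "card (bounded_msets (Suc R) x)
     = (\<Sum>n | 1 \<le> n \<and> real n ^ Suc R \<le> x. card (bounded_msets R (x / real n ^ Suc R)))"
  unfolding bij_betw_same_card[OF bij_betw_bounded_msets_Suc, symmetric]
  by (intro card_SigmaI finite_nat_power_le ballI finite_bounded_msets)

text \<open>The recursion as a series over all \<open>n \<ge> 1\<close>, ready for termwise
  comparison with the zeta series: terms with \<open>n ^ Suc R > x\<close> vanish, as no multiset
  has product below 1.\<close>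

lemma card_bounded_msets_Suc_sums:
  "(\<lambda>n. real (card (bounded_msets R (x / real (Suc n) ^ Suc R))))
     sums real (card (bounded_msets (Suc R) x))"
proof -
  define A where "A = {n::nat. 1 \<le> n \<and> real n ^ Suc R \<le> x}"
  define f where "f = (\<lambda>n. real (card (bounded_msets R (x / real n ^ Suc R))))"
  have A: "A = Suc ` {n. Suc n \<in> A}"
  proof (intro equalityI subsetI)
    fix n assume "n \<in> A"
    moreover from this have "n = Suc (n - 1)" by (simp add: A_def)
    ultimately show "n \<in> Suc ` {n. Suc n \<in> A}" by (metis image_eqI mem_Collect_eq)
  qed auto
  have fin: "finite {n. Suc n \<in> A}"
    using finite_vimageI[of A Suc] finite_nat_power_le[of R x] by (simp add: A_def vimage_def del: power_Suc)
  have "(\<lambda>n. f (Suc n)) sums (\<Sum>n | Suc n \<in> A. f (Suc n))"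
  proof (rule sums_finite[OF fin])
    fix n assume "n \<notin> {n. Suc n \<in> A}"
    then have "\<not> real (Suc n) ^ Suc R \<le> x" by (simp add: A_def)
    then have "x / real (Suc n) ^ Suc R < 1" by (simp add: divide_less_eq del: power_Suc)
    then show "f (Suc n) = 0" by (simp add: f_def bounded_msets_empty del: power_Suc)
  qed
  also have "(\<Sum>n | Suc n \<in> A. f (Suc n)) = sum f A"
    by (subst (2) A) (simp add: sum.reindex)
  also have "sum f A = real (card (bounded_msets (Suc R) x))"
    by (simp add: card_bounded_msets_Suc f_def A_def del: power_Suc)
  finally show ?thesis by (simp add: f_def)
qed

section \<open>Zeta at integers and the infinite product\<close>

lemma zeta_nat_sums:
  assumes "2 \<le> s"
  shows "(\<lambda>n. 1 / real (Suc n) ^ s) sums zeta (real s)"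
proof -
  have "summable (\<lambda>n. inverse (real n ^ s))" using assms by (rule inverse_power_summable)
  then have "summable (\<lambda>n. inverse (real (Suc n) ^ s))" by (subst summable_Suc_iff)
  then show ?thesis
    by (simp add: zeta_def powr_realpow sums_iff inverse_eq_divide)
qed

lemma one_le_zeta_nat:
  assumes "2 \<le> s" shows "1 \<le> zeta (real s)"
  using sum_le_suminf[of "\<lambda>n. 1 / real (Suc n) ^ s" "{0}"] zeta_nat_sums[OF assms]
  by (simp add: sums_iff)

text \<open>For \<open>n \<ge> 2\<close> the factor \<open>n ^ r\<close> in the denominator is at
  least \<open>2 ^ r\<close>. The geometric decay gives convergence of the product.\<close>

lemma zeta_nat_minus_one_le:
  "zeta (real (r + 2)) - 1 \<le> (1 / 2) ^ r * zeta 2"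
proof -
  have s: "(\<lambda>n. 1 / real (Suc (Suc n)) ^ (r + 2)) sums (zeta (real (r + 2)) - 1)" for r
    using zeta_nat_sums[of "r + 2"] by (subst sums_Suc_iff) simp
  have "zeta (real (r + 2)) - 1 \<le> (1 / 2) ^ r * (zeta (real (0 + 2)) - 1)"
  proof (rule sums_le[OF _ s sums_mult[OF s[of 0]]])
    fix n
    have "1 / a ^ (r + 2) = (1 / a) ^ r * (1 / a ^ 2)" for a :: real
      by (simp add: power_add power_one_over power2_eq_square)
    then have "1 / real (Suc (Suc n)) ^ (r + 2) = (1 / real (Suc (Suc n))) ^ r * (1 / real (Suc (Suc n)) ^ 2)" .
    also have "\<dots> \<le> (1 / 2) ^ r * (1 / real (Suc (Suc n)) ^ 2)"
      by (intro mult_right_mono power_mono) auto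
    finally show "1 / real (Suc (Suc n)) ^ (r + 2) \<le> (1 / 2) ^ r * (1 / real (Suc (Suc n)) ^ (0 + 2))"
      by (simp only: add_0_left)
  qed
  also have "\<dots> \<le> (1 / 2) ^ r * zeta 2" by (simp add: mult_left_mono)
  finally show ?thesis .
qed

lemma convergent_prod_zeta: "convergent_prod (\<lambda>r. zeta (real (r + 2)))"
proof -
  have "summable (\<lambda>r. norm (zeta (real (r + 2)) - 1))"
  proof (rule summable_comparison_test')
    show "summable (\<lambda>r. (1 / 2) ^ r * zeta 2)"
      by (intro summable_mult2 summable_geometric) simp
    show "norm (norm (zeta (real (r + 2)) - 1)) \<le> (1 / 2) ^ r * zeta 2" for r
      using zeta_nat_minus_one_le[of r] one_le_zeta_nat[of "r + 2"] by simp
  qed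
  then show ?thesis
    by (intro abs_convergent_prod_imp_convergent_prod summable_imp_abs_convergent_prod)
qed

text \<open>The factors are the zeta values at 2 up to \<open>j + 1\<close>, so
  \<open>zeta_prod j\<close> belongs to the exponent bound \<open>Suc j\<close>: exponent 1
  contributes the linear growth in \<open>x\<close> instead of a zeta value.\<close>

definition zeta_prod :: "nat \<Rightarrow> real" where
  "zeta_prod j = (\<Prod>r<j. zeta (real (r + 2)))"

text \<open>The limit mean, over orders up to \<open>x\<close>, of the number of abelian groups of a
  given order, from the theorem of Erdos and Szekeres.\<close>

abbreviation erdos_szekeres_const :: real where
  "erdos_szekeres_const \<equiv> (\<Prod>r. zeta (real (r + 2)))"

lemma one_le_zeta_prod: "1 \<le> zeta_prod j"
  unfolding zeta_prod_def by (intro prod_ge_1 one_le_zeta_nat) auto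

lemma zeta_prod_le: "zeta_prod j \<le> erdos_szekeres_const"
  unfolding zeta_prod_def
  by (rule prod_le_prodinf[OF convergent_prod_has_prod[OF convergent_prod_zeta]])
    (use order_trans[OF zero_le_one one_le_zeta_nat[of "_ + 2"]] one_le_zeta_nat[of "_ + 2"] in simp_all)

lemma zeta_prod_LIMSEQ: "zeta_prod \<longlonglongrightarrow> erdos_szekeres_const"
proof -
  have "(\<lambda>j. zeta_prod (Suc j)) \<longlonglongrightarrow> erdos_szekeres_const"
    using convergent_prod_LIMSEQ[OF convergent_prod_zeta] by (simp add: zeta_prod_def lessThan_Suc_atMost)
  then show ?thesis by (rule LIMSEQ_imp_Suc)
qed

lemma card_bounded_msets_0: "card (bounded_msets 0 x) = (if 1 \<le> x then 1 else 0)"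
proof (cases "1 \<le> x")
  case True
  have "M = {#}" if "M \<in> bounded_msets 0 x" for M
  proof (rule multiset_eqI)
    fix q
    have "q \<notin># M" using that primepow_exponentE[of q] by (force simp: bounded_msets_def)
    then show "count M q = count {#} q" by (simp add: count_eq_zero_iff)
  qed
  moreover have "{#} \<in> bounded_msets 0 x" using True by (simp add: bounded_msets_def)
  ultimately have "bounded_msets 0 x = {{#}}" by blast
  then show ?thesis using True by simp
qed (simp add: bounded_msets_empty)

text \<open>With exponents at most 1 the multisets consist of primes and are the prime
  factorizations of the integers from 1 to \<open>x\<close>.\<close>

lemma card_bounded_msets_1: "card (bounded_msets 1 x) = nat \<lfloor>x\<rfloor>"
proof -
  have "card (bounded_msets (Suc 0) x) = (\<Sum>n | 1 \<le> n \<and> real n \<le> x. card (bounded_msets 0 (x / real n)))"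
    using card_bounded_msets_Suc[of 0 x] by simp
  also have "\<dots> = (\<Sum>n | 1 \<le> n \<and> real n \<le> x. 1)"
    by (intro sum.cong refl) (simp add: card_bounded_msets_0 divide_simps)
  also have "{n. 1 \<le> n \<and> real n \<le> x} = {1..nat \<lfloor>x\<rfloor>}"
  proof (rule Set.set_eqI)
    fix n
    have "real n \<le> x" if "1 \<le> n" "n \<le> nat \<lfloor>x\<rfloor>" using that by linarith
    then have "1 \<le> n \<Longrightarrow> real n \<le> x \<longleftrightarrow> n \<le> nat \<lfloor>x\<rfloor>" using le_nat_floor by blast
    then show "n \<in> {n. 1 \<le> n \<and> real n \<le> x} \<longleftrightarrow> n \<in> {1..nat \<lfloor>x\<rfloor>}" by auto
  qed
  finally show ?thesis by simp
qed

text \<open>Applying the bound for \<open>j\<close> to each term of the recursion produces the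
  series of \<open>zeta (j + 2)\<close>. The bound holds for every \<open>x \<ge> 0\<close>, so it
  can also serve as the dominating term in the limit below.\<close>

lemma card_bounded_msets_le:
  assumes "0 \<le> x"
  shows "real (card (bounded_msets (Suc j) x)) \<le> zeta_prod j * x"
  using assms
proof (induction j arbitrary: x)
  case 0
  then show ?case by (simp add: card_bounded_msets_1[simplified] zeta_prod_def)
next
  case (Suc j)
  have sums: "(\<lambda>n. zeta_prod j * (x * (1 / real (Suc n) ^ (j + 2)))) sums (zeta_prod j * (x * zeta (real (j + 2))))"
    by (intro sums_mult zeta_nat_sums) simp
  have le: "real (card (bounded_msets (Suc j) (x / real (Suc n) ^ Suc (Suc j))))
      \<le> zeta_prod j * (x * (1 / real (Suc n) ^ (j + 2)))" for n
    using Suc.IH[of "x / real (Suc n) ^ Suc (Suc j)"] Suc.prems by simp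
  have "real (card (bounded_msets (Suc (Suc j)) x)) \<le> zeta_prod j * (x * zeta (real (j + 2)))"
    by (rule sums_le[OF le card_bounded_msets_Suc_sums sums])
  then show ?case by (simp add: zeta_prod_def mult_ac)
qed

text \<open>Divide the recursion by \<open>x\<close>: each term tends to
  \<open>zeta_prod j / n ^ (j + 2)\<close>, and \<open>card_bounded_msets_le\<close> dominates it by
  the same quantity, so Tannery's theorem permits the limit under the sum.\<close>

lemma card_bounded_msets_tendsto:
  "((\<lambda>x. real (card (bounded_msets (Suc j) x)) / x) \<longlongrightarrow> zeta_prod j) at_top"
proof (induction j)
  case 0
  have "((\<lambda>x. real (nat \<lfloor>x\<rfloor>) / x) \<longlongrightarrow> 1) at_top" by real_asymp
  then show ?case by (simp add: card_bounded_msets_1[simplified] zeta_prod_def)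
next
  case (Suc j)
  define N where "N = (\<lambda>x. real (card (bounded_msets (Suc j) x)))"
  define a where "a = (\<lambda>n x. N (x / real (Suc n) ^ (j + 2)) / x)"
  have "((\<lambda>x. \<Sum>n. a n x) \<longlongrightarrow> (\<Sum>n. zeta_prod j * (1 / real (Suc n) ^ (j + 2)))) at_top"
  proof (rule tannerys_theorem[THEN conjunct2, THEN conjunct2])
    fix n
    define c where "c = real (Suc n) ^ (j + 2)"
    have c: "c > 0" by (simp add: c_def)
    have "filterlim (\<lambda>x. x / c) at_top at_top" using c by real_asymp
    from filterlim_compose[OF Suc.IH this]
    have "((\<lambda>x. N (x / c) / (x / c) * (1 / c)) \<longlongrightarrow> zeta_prod j * (1 / c)) at_top"
      unfolding N_def by (intro tendsto_mult tendsto_const)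
    then show "((\<lambda>x. a n x) \<longlongrightarrow> zeta_prod j * (1 / real (Suc n) ^ (j + 2))) at_top"
      unfolding a_def c_def[symmetric] using c by simp
  next
    have b: "norm (a n x) \<le> zeta_prod j * (1 / real (Suc n) ^ (j + 2))" if "x > 0" for n x
      using card_bounded_msets_le[of "x / real (Suc n) ^ (j + 2)" j] that
      by (simp add: a_def N_def divide_le_eq mult_ac)
    have "\<forall>\<^sub>F z in sequentially \<times>\<^sub>F at_top. 0 < snd (z :: nat \<times> real)"
      by (rule eventually_compose_filterlim[OF eventually_gt_at_top filterlim_snd])
    then show "\<forall>\<^sub>F (n, x) in at_top \<times>\<^sub>F at_top. norm (a n x) \<le> zeta_prod j * (1 / real (Suc n) ^ (j + 2))"
      by (rule eventually_mono) (use b in \<open>simp only: case_prod_unfold\<close>)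
    show "summable (\<lambda>n. zeta_prod j * (1 / real (Suc n) ^ (j + 2)))"
      by (intro summable_mult sums_summable[OF zeta_nat_sums]) simp
  qed auto
  moreover have "(\<Sum>n. zeta_prod j * (1 / real (Suc n) ^ (j + 2))) = zeta_prod (Suc j)"
    using sums_mult[OF zeta_nat_sums[of "j + 2"], of "zeta_prod j"] by (simp add: sums_iff zeta_prod_def)
  moreover have "(\<Sum>n. a n x) = real (card (bounded_msets (Suc (Suc j)) x)) / x" for x
    using sums_divide[OF card_bounded_msets_Suc_sums[of "Suc j" x], of x]
    by (simp add: sums_iff a_def N_def)
  ultimately show ?case by simp
qed

text \<open>The term \<open>n = 1\<close> of the recursion is the count with exponent bound
  \<open>Suc j\<close> itself. The other terms are bounded by the zeta series without its first
  term.\<close>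

lemma card_bounded_msets_diff_le:
  assumes "0 \<le> x"
  shows "real (card (bounded_msets (Suc (Suc j)) x)) - real (card (bounded_msets (Suc j) x))
    \<le> (zeta_prod (Suc j) - zeta_prod j) * x"
proof -
  define f where "f = (\<lambda>n. real (card (bounded_msets (Suc j) (x / real (Suc n) ^ (j + 2)))))"
  define g where "g = (\<lambda>n. zeta_prod j * (x * (1 / real (Suc n) ^ (j + 2))))"
  have "f sums real (card (bounded_msets (Suc (Suc j)) x))"
    using card_bounded_msets_Suc_sums[of "Suc j" x] by (simp add: f_def)
  \<comment> \<open>Because of the index shift, \<open>f 0\<close> is the term for
    \<open>n = 1\<close>.\<close>
  then have f: "(\<lambda>n. f (Suc n)) sums (real (card (bounded_msets (Suc (Suc j)) x)) - f 0)"
    by (subst sums_Suc_iff) simp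
  have "g sums (zeta_prod j * (x * zeta (real (j + 2))))"
    unfolding g_def by (intro sums_mult zeta_nat_sums) simp
  then have g: "(\<lambda>n. g (Suc n)) sums (zeta_prod j * (x * zeta (real (j + 2))) - g 0)"
    by (subst sums_Suc_iff) simp
  have "f n \<le> g n" for n
    using card_bounded_msets_le[of "x / real (Suc n) ^ (j + 2)" j] assms by (simp add: f_def g_def)
  then have "real (card (bounded_msets (Suc (Suc j)) x)) - f 0 \<le> zeta_prod j * (x * zeta (real (j + 2))) - g 0"
    by (intro sums_le[OF _ f g])
  then show ?thesis by (simp add: f_def g_def zeta_prod_def algebra_simps)
qed

text \<open>A prime power of exponent above \<open>R\<close> is at least
  \<open>2 ^ Suc R > x\<close>, too large to occur.\<close>

lemma bounded_msets_eq_smooth_msets: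
  assumes "x < 2 ^ Suc R"
  shows "bounded_msets R x = smooth_msets x x"
proof (intro equalityI subsetI)
  fix M assume M: "M \<in> bounded_msets R x"
  then have "\<forall>q\<in>#M. 2 \<le> q" using primepow_ge_two by (auto simp: bounded_msets_def)
  then have "real q \<le> x" if "q \<in># M" for q
    using mem_le_prod_mset[OF _ that] M by (fastforce simp: bounded_msets_def)
  with M show "M \<in> smooth_msets x x" by (auto simp: bounded_msets_def smooth_msets_def)
next
  fix M assume M: "M \<in> smooth_msets x x"
  have "exponent q \<le> R" if q: "q \<in># M" for q
  proof (rule ccontr)
    assume "\<not> exponent q \<le> R"
    have "primepow q" using M q by (auto simp: smooth_msets_def)
    then obtain p where p: "prime p" "q = p ^ exponent q" by (rule primepow_exponentE)
    have "2 ^ Suc R \<le> (2::nat) ^ exponent q" using \<open>\<not> exponent q \<le> R\<close> by (intro power_increasing) auto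
    also have "\<dots> \<le> p ^ exponent q" using p(1) by (intro power_mono prime_ge_2_nat) auto
    finally have "2 ^ Suc R \<le> q" using p(2) by simp
    then have "2 ^ Suc R \<le> real q" by (metis of_nat_le_iff of_nat_numeral of_nat_power)
    moreover have "real q \<le> x" using M q by (auto simp: smooth_msets_def)
    ultimately show False using assms by linarith
  qed
  with M show "M \<in> bounded_msets R x" by (auto simp: bounded_msets_def smooth_msets_def)
qed

lemma ex_bounded_msets_eq_smooth_msets:
  "\<exists>J. \<forall>j\<ge>J. bounded_msets (Suc j) x = smooth_msets x x"
proof -
  obtain J where "x < 2 ^ J" using real_arch_pow[of 2 x] by auto
  then have "x < 2 ^ Suc (Suc j)" if "j \<ge> J" for j
    using power_increasing[of J "Suc (Suc j)" "2::real"] that by linarith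
  then show ?thesis using bounded_msets_eq_smooth_msets by blast
qed

lemma card_smooth_msets_le:
  assumes "0 \<le> x"
  shows "real (card (smooth_msets x x)) \<le> erdos_szekeres_const * x"
proof -
  obtain J where "bounded_msets (Suc J) x = smooth_msets x x"
    using ex_bounded_msets_eq_smooth_msets by blast
  then have "real (card (smooth_msets x x)) \<le> zeta_prod J * x"
    using card_bounded_msets_le[OF assms, of J] by simp
  also have "\<dots> \<le> erdos_szekeres_const * x" using assms by (intro mult_right_mono zeta_prod_le)
  finally show ?thesis .
qed

text \<open>The exponent bound at which the counts stabilize depends on \<open>x\<close>.
  Telescoping the differences from \<open>j\<close> up to that bound gives an error proportional to
  \<open>x\<close> whose factor depends on \<open>j\<close> alone.\<close>

lemma card_smooth_msets_bounds:
  assumes "0 \<le> x"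
  shows "real (card (bounded_msets (Suc j) x)) \<le> real (card (smooth_msets x x))"
    and "real (card (smooth_msets x x))
      \<le> real (card (bounded_msets (Suc j) x)) + (erdos_szekeres_const - zeta_prod j) * x"
proof -
  obtain J where J: "\<And>i. i \<ge> J \<Longrightarrow> bounded_msets (Suc i) x = smooth_msets x x"
    using ex_bounded_msets_eq_smooth_msets by blast
  define m where "m = max j J"
  have m: "bounded_msets (Suc m) x = smooth_msets x x" "j \<le> m" using J by (auto simp: m_def)
  have "bounded_msets (Suc j) x \<subseteq> bounded_msets (Suc m) x"
    using m(2) by (auto simp: bounded_msets_def)
  then have "card (bounded_msets (Suc j) x) \<le> card (bounded_msets (Suc m) x)"
    by (intro card_mono) auto
  with m show "real (card (bounded_msets (Suc j) x)) \<le> real (card (smooth_msets x x))" by simp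
  have "real (card (bounded_msets (Suc m) x))
      \<le> real (card (bounded_msets (Suc j) x)) + (zeta_prod m - zeta_prod j) * x"
    using m(2)
  proof (induction m rule: dec_induct)
    case (step m)
    then show ?case using card_bounded_msets_diff_le[OF assms, of m] by (simp add: algebra_simps)
  qed simp
  also have "\<dots> \<le> real (card (bounded_msets (Suc j) x)) + (erdos_szekeres_const - zeta_prod j) * x"
    using assms zeta_prod_le[of m] by (intro add_left_mono mult_right_mono) auto
  finally show "real (card (smooth_msets x x))
      \<le> real (card (bounded_msets (Suc j) x)) + (erdos_szekeres_const - zeta_prod j) * x"
    using m by simp
qed

text \<open>First fix \<open>j\<close> so that the tail of the product is below
  \<open>e / 2\<close>, uniformly in \<open>x\<close>; then let \<open>x\<close> grow for this
  \<open>j\<close>.\<close>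

lemma card_smooth_msets_asymptotic:
  "((\<lambda>x. real (card (smooth_msets x x)) / x) \<longlongrightarrow> erdos_szekeres_const) at_top"
proof (rule tendstoI)
  fix e :: real assume e: "e > 0"
  have "\<forall>\<^sub>F j in sequentially. dist (zeta_prod j) erdos_szekeres_const < e / 2"
    using e by (intro tendstoD[OF zeta_prod_LIMSEQ]) simp
  then obtain j where "dist (zeta_prod j) erdos_szekeres_const < e / 2"
    by (auto simp: eventually_sequentially)
  then have j: "erdos_szekeres_const - zeta_prod j < e / 2" unfolding dist_real_def by linarith
  have "\<forall>\<^sub>F x in at_top. dist (real (card (bounded_msets (Suc j) x)) / x) (zeta_prod j) < e / 2"
    using e by (intro tendstoD[OF card_bounded_msets_tendsto]) simp
  then show "\<forall>\<^sub>F x in at_top. dist (real (card (smooth_msets x x)) / x) erdos_szekeres_const < e"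
    using eventually_gt_at_top[of "0::real"]
  proof eventually_elim
    case (elim x)
    have "real (card (bounded_msets (Suc j) x)) / x \<le> real (card (smooth_msets x x)) / x"
      using elim card_smooth_msets_bounds(1)[of x j] by (simp add: divide_right_mono)
    moreover have "real (card (smooth_msets x x)) / x
        \<le> real (card (bounded_msets (Suc j) x)) / x + (erdos_szekeres_const - zeta_prod j)"
      using elim card_smooth_msets_bounds(2)[of x j] by (simp add: field_simps)
    ultimately show ?case using elim(1) j zeta_prod_le[of j] unfolding dist_real_def by linarith
  qed
qed

section \<open>Buchstab's identity\<close>

lemma smooth_msets_mem_le:
  assumes "M \<in> smooth_msets x y" "q \<in># M"
  shows "real q \<le> x"
proof -
  have "\<forall>q\<in>#M. 2 \<le> q" using assms(1) primepow_ge_two by (auto simp: smooth_msets_def)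
  then have "q \<le> prod_mset M" using assms(2) by (rule mem_le_prod_mset)
  then show ?thesis using assms(1) by (auto simp: smooth_msets_def)
qed

lemma smooth_msets_subset: "smooth_msets x y \<subseteq> smooth_msets x x"
proof
  fix M assume M: "M \<in> smooth_msets x y"
  with smooth_msets_mem_le[OF M] show "M \<in> smooth_msets x x" by (auto simp: smooth_msets_def)
qed

lemma smooth_msets_ge_eq: "x \<le> y \<Longrightarrow> smooth_msets x y = smooth_msets x x"
  using smooth_msets_subset[of x y] by (auto simp: smooth_msets_def intro: order_trans)

definition primepows_between :: "real \<Rightarrow> real \<Rightarrow> nat set" where
  "primepows_between a b = {q \<in> nats_between a b. primepow q}"

lemma finite_primepows_between [simp, intro]: "finite (primepows_between a b)"
  by (simp add: primepows_between_def)

lemma add_mset_mem_smooth_msets_iff: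
  assumes "primepow q"
  shows "add_mset q M \<in> smooth_msets x (real q) \<longleftrightarrow> M \<in> smooth_msets (x / real q) (real q)"
  using primepow_gt_0_nat[OF assms] assms
  by (auto simp: smooth_msets_def field_simps)

lemma buchstab_identity:
  "card (smooth_msets x x) = card (smooth_msets x y)
     + (\<Sum>q\<in>primepows_between y x. card (smooth_msets (x / real q) (real q)))"
proof -
  \<comment> \<open>\<open>D q\<close> consists of the multisets with largest element
    \<open>q\<close>. Since \<open>q\<close> may occur repeatedly, the remaining elements are
    bounded by \<open>q\<close> itself. The sets are disjoint because a multiset determines its
    largest element.\<close>
  define D where "D = (\<lambda>q. add_mset q ` smooth_msets (x / real q) (real q))"
  have D: "M \<in> smooth_msets x (real q)" "q \<in># M" "\<forall>r\<in>#M. r \<le> q" "primepow q"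
    if "M \<in> D q" "q \<in> primepows_between y x" for M q
  proof -
    show pp: "primepow q" using that by (auto simp: primepows_between_def)
    show M: "M \<in> smooth_msets x (real q)" "q \<in># M"
      using that add_mset_mem_smooth_msets_iff[OF pp, of _ x] by (auto simp: D_def)
    then show "\<forall>r\<in>#M. r \<le> q" by (auto simp: smooth_msets_def)
  qed
  have un: "smooth_msets x x = smooth_msets x y \<union> (\<Union>q\<in>primepows_between y x. D q)"
  proof (intro equalityI subsetI)
    fix M assume M: "M \<in> smooth_msets x x"
    show "M \<in> smooth_msets x y \<union> (\<Union>q\<in>primepows_between y x. D q)"
    proof (cases "M \<in> smooth_msets x y")
      case False
      then obtain r where r: "r \<in># M" "y < real r" using M by (auto simp: smooth_msets_def not_le)
      define q where "q = Max (set_mset M)"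
      have q: "q \<in># M" "\<And>s. s \<in># M \<Longrightarrow> s \<le> q"
        unfolding q_def using r by (auto intro!: Max_in)
      have pp: "primepow q" using q M by (auto simp: smooth_msets_def)
      have "y < real q" using q(2)[OF r(1)] r(2) by linarith
      moreover have "real q \<le> x" using smooth_msets_mem_le[OF M q(1)] .
      ultimately have qm: "q \<in> primepows_between y x"
        using pp by (simp add: primepows_between_def nats_between_def)
      have eq: "add_mset q (M - {#q#}) = M" using q(1) by simp
      have "M \<in> smooth_msets x (real q)" using M q(2) by (auto simp: smooth_msets_def)
      then have "M - {#q#} \<in> smooth_msets (x / real q) (real q)"
        using add_mset_mem_smooth_msets_iff[OF pp, of "M - {#q#}" x] unfolding eq by simp
      then have "M \<in> D q" unfolding D_def using eq by (metis image_eqI)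
      with qm show ?thesis by blast
    qed simp
  next
    fix M assume "M \<in> smooth_msets x y \<union> (\<Union>q\<in>primepows_between y x. D q)"
    then show "M \<in> smooth_msets x x" using D(1) smooth_msets_subset by blast
  qed
  have "card (smooth_msets x x) = card (smooth_msets x y) + card (\<Union>q\<in>primepows_between y x. D q)"
    unfolding un
  proof (rule card_Un_disjoint)
    have "M \<notin> smooth_msets x y" if "M \<in> D q" "q \<in> primepows_between y x" for M q
      using D(2)[OF that] that(2) by (fastforce simp: smooth_msets_def primepows_between_def nats_between_def)
    then show "smooth_msets x y \<inter> (\<Union>q\<in>primepows_between y x. D q) = {}" by blast
  qed (auto simp: D_def)
  also have "card (\<Union>q\<in>primepows_between y x. D q) = (\<Sum>q\<in>primepows_between y x. card (D q))"
  proof (rule card_UN_disjoint)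
    show "\<forall>q\<in>primepows_between y x. \<forall>r\<in>primepows_between y x. q \<noteq> r \<longrightarrow> D q \<inter> D r = {}"
    proof (intro ballI impI)
      fix q r assume qr: "q \<in> primepows_between y x" "r \<in> primepows_between y x" "q \<noteq> r"
      have False if "M \<in> D q" "M \<in> D r" for M
        using D(2,3)[OF that(1) qr(1)] D(2,3)[OF that(2) qr(2)] qr(3) by (meson order_antisym)
      then show "D q \<inter> D r = {}" by blast
    qed
  qed (auto simp: D_def)
  also have "\<dots> = (\<Sum>q\<in>primepows_between y x. card (smooth_msets (x / real q) (real q)))"
    by (intro sum.cong refl) (auto simp: D_def card_image inj_on_def)
  finally show ?thesis .
qed

section \<open>The Dickman function\<close>

lemma dickman_DERIV:
  assumes "is_dickman \<rho>" "1 < u"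
  shows "(\<rho> has_real_derivative - \<rho> (u - 1) / u) (at u)"
proof -
  have "\<rho> differentiable (at u)" "u * deriv \<rho> u + \<rho> (u - 1) = 0"
    using assms by (auto simp: is_dickman_def)
  moreover from this(2) have "deriv \<rho> u = - \<rho> (u - 1) / u" using assms(2) by (simp add: field_simps)
  ultimately show ?thesis
    by (metis DERIV_deriv_iff_real_differentiable)
qed

text \<open>The integral of \<rho> over \<open>[u - 1, u]\<close>. Both sides have derivative
  \<open>\<rho> u - \<rho> (u - 1)\<close> for \<open>u > 1\<close> and equal 1 at
  \<open>u = 1\<close>. Integrals from 0 let the fundamental theorem apply to the upper
  limit.\<close>

lemma dickman_integral_eq:
  assumes "is_dickman \<rho>" "1 \<le> u"
  shows "u * \<rho> u = integral {0..u} \<rho> - integral {0..u - 1} \<rho>"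
proof -
  define I where "I = (\<lambda>u. integral {0..u} \<rho>)"
  have cont: "continuous_on {0..b} \<rho>" for b
    using assms(1) by (auto simp: is_dickman_def intro: continuous_on_subset)
  have I0: "(I has_real_derivative \<rho> t) (at t)" if "0 < t" for t
  proof -
    have "(I has_real_derivative \<rho> t) (at t within {0..t + 1})"
      unfolding I_def using that by (intro integral_has_real_derivative cont) auto
    then show ?thesis using that by (simp add: at_within_Icc_at)
  qed
  have Icont: "continuous_on {0..b} I" for b
    unfolding I_def by (intro indefinite_integral_continuous_1 integrable_continuous_real cont)
  define H where "H = (\<lambda>u. u * \<rho> u - I u + I (u - 1))"
  have one: "\<rho> t = 1" if "0 \<le> t" "t \<le> 1" for t using assms(1) that by (simp add: is_dickman_def)
  have "I 1 = integral {0..1::real} (\<lambda>_. 1::real)"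
    unfolding I_def by (rule integral_cong) (auto intro: one)
  then have H1: "H 1 = 0" by (simp add: H_def one) (simp add: I_def)
  have "H u = 0"
  proof (cases "u = 1")
    case False
    have "H u = H 1"
    proof (rule DERIV_isconst_end[where f = H])
      have "continuous_on {1..u} (\<lambda>u. I (u - 1))"
        by (rule continuous_on_compose2[OF Icont[of "u - 1"]]) (auto intro!: continuous_intros)
      then show "continuous_on {1..u} H" unfolding H_def
        by (intro continuous_intros continuous_on_subset[OF cont[of u]] continuous_on_subset[OF Icont[of u]]) auto
      fix t assume t: "1 < t" "t < u"
      have "((\<lambda>u. I (u - 1)) has_real_derivative \<rho> (t - 1) * 1) (at t)"
        by (rule DERIV_chain2[OF I0]) (use t in \<open>auto intro!: derivative_eq_intros\<close>)
      then have "(H has_real_derivative (1 * \<rho> t + (- \<rho> (t - 1) / t) * t) - \<rho> t + \<rho> (t - 1) * 1) (at t)"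
        unfolding H_def using t
        by (intro DERIV_add DERIV_diff DERIV_mult DERIV_ident dickman_DERIV[OF assms(1)] I0) auto
      then show "(H has_real_derivative 0) (at t)" using t by simp
    qed (use assms(2) False in auto)
    with H1 show ?thesis by simp
  qed (simp add: H1)
  then show ?thesis by (simp add: H_def I_def)
qed

text \<open>At the first point \<open>v\<close> with \<open>\<rho> v \<le> 0\<close> one has
  \<open>v > 1\<close>, and \<open>v * \<rho> v\<close> is the integral of \<rho> over
  \<open>[v - 1, v]\<close>, where \<rho> is positive before \<open>v\<close>.\<close>

lemma dickman_pos:
  assumes "is_dickman \<rho>" "0 \<le> u"
  shows "0 < \<rho> u"
proof (rule ccontr)
  assume "\<not> 0 < \<rho> u"
  define S where "S = {t \<in> {0..}. \<rho> t \<in> {..0}}"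
  have cont: "continuous_on {0..} \<rho>" using assms(1) by (simp add: is_dickman_def)
  have "S = {0..} \<inter> \<rho> -` {..0}" by (auto simp: S_def)
  then have "closed S" using continuous_closed_preimage[OF cont, of "{..0}"] by simp
  moreover have ne: "S \<noteq> {}" using assms(2) \<open>\<not> 0 < \<rho> u\<close> by (auto simp: S_def)
  moreover have bdd: "bdd_below S" by (auto simp: S_def intro: bdd_belowI[of _ 0])
  ultimately have "Inf S \<in> S" by (intro closed_contains_Inf)
  define v where "v = Inf S"
  have v: "0 \<le> v" "\<rho> v \<le> 0" using \<open>Inf S \<in> S\<close> by (auto simp: v_def S_def)
  have pos: "\<rho> t > 0" if "0 \<le> t" "t < v" for t
  proof (rule ccontr)
    assume "\<not> \<rho> t > 0"
    then have "t \<in> S" using that by (auto simp: S_def)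
    then have "v \<le> t" unfolding v_def by (intro cInf_lower bdd)
    with that show False by simp
  qed
  have v1: "1 < v"
  proof (rule ccontr)
    assume "\<not> 1 < v"
    then have "\<rho> v = 1" using v assms(1) by (simp add: is_dickman_def)
    with v show False by simp
  qed
  \<comment> \<open>The mean value theorem makes the integral equal to \<open>\<rho> z\<close> with
    \<open>z\<close> strictly below \<open>v\<close>, so positivity is used only where it is
    known.\<close>
  have "\<exists>l z. v - 1 < z \<and> z < v \<and> DERIV (\<lambda>u. integral {0..u} \<rho>) z :> l
      \<and> integral {0..v} \<rho> - integral {0..v - 1} \<rho> = (v - (v - 1)) * l"
    (is "\<exists>l z. ?P l z")
  proof (rule MVT)
    show "continuous_on {v - 1..v} (\<lambda>u. integral {0..u} \<rho>)"
      using v1 by (intro continuous_on_subset[OF indefinite_integral_continuous_1[of \<rho> 0 v]]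
          integrable_continuous_real continuous_on_subset[OF cont]) auto
    fix z assume z: "v - 1 < z" "z < v"
    have "((\<lambda>u. integral {0..u} \<rho>) has_real_derivative \<rho> z) (at z within {0..v})"
      using z v1 by (intro integral_has_real_derivative continuous_on_subset[OF cont]) auto
    then show "(\<lambda>u. integral {0..u} \<rho>) differentiable (at z)"
      using z v1 by (auto simp: at_within_Icc_at real_differentiable_def)
  qed simp
  then obtain l z where z: "?P l z" by blast
  have "((\<lambda>u. integral {0..u} \<rho>) has_real_derivative \<rho> z) (at z within {0..v})"
    using z v1 by (intro integral_has_real_derivative continuous_on_subset[OF cont]) auto
  then have "DERIV (\<lambda>u. integral {0..u} \<rho>) z :> \<rho> z"
    using z v1 by (simp add: at_within_Icc_at)
  then have "l = \<rho> z" using z DERIV_unique by blast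
  then have "0 < l" using pos z v1 by simp
  moreover have "v * \<rho> v = l" using dickman_integral_eq[OF assms(1), of v] z v1 by simp
  moreover have "v * \<rho> v \<le> 0" using v by (rule mult_nonneg_nonpos)
  ultimately show False by linarith
qed

section \<open>Sums over prime powers\<close>

lemma sum_nats_between_combine:
  assumes "a \<le> b" "b \<le> c"
  shows "sum f (nats_between a c) = sum f (nats_between a b) + sum f (nats_between b c)"
proof -
  have "nats_between a c = nats_between a b \<union> nats_between b c" "nats_between a b \<inter> nats_between b c = {}"
    using assms by (auto simp: nats_between_def)
  then show ?thesis by (simp add: sum.union_disjoint)
qed

text \<open>On a short interval \<open>g\<close> is nearly constant. Replacing it by its value at
  the mean value point of \<phi> costs \<eta> times the total weight, and this weight differs from
  \<open>t - s\<close> by at most \<open>10 / ln x\<close>; \<open>B\<close> bounds the effect of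
  that difference.\<close>

lemma mertens_weighted_piece:
  fixes g \<phi> :: "real \<Rightarrow> real"
  assumes x: "1 < x" and st: "0 \<le> s" "s \<le> t" and nonneg: "0 \<le> \<eta>" "0 \<le> B"
    and bound: "\<And>z. s \<le> z \<Longrightarrow> z \<le> t \<Longrightarrow> \<bar>g z\<bar> \<le> B"
    and osc: "\<And>z w. s \<le> z \<Longrightarrow> z \<le> t \<Longrightarrow> s \<le> w \<Longrightarrow> w \<le> t \<Longrightarrow> \<bar>g z - g w\<bar> \<le> \<eta>"
    and cont: "continuous_on {s..t} \<phi>"
    and deriv: "\<And>z. s < z \<Longrightarrow> z < t \<Longrightarrow> (\<phi> has_real_derivative g z) (at z)"
  shows "\<bar>(\<Sum>n\<in>nats_between (x powr s) (x powr t). mangoldt n / (real n * ln x) * g (ln (real n) / ln x))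
      - (\<phi> t - \<phi> s)\<bar> \<le> \<eta> * (t - s) + (\<eta> + B) * (10 / ln x)"
proof (cases "s = t")
  case True
  then have "nats_between (x powr s) (x powr t) = {}" by (auto simp: nats_between_def)
  moreover have "0 \<le> (\<eta> + B) * (10 / ln x)" using nonneg x by simp
  ultimately show ?thesis using True by simp
next
  case False
  define A where "A = nats_between (x powr s) (x powr t)"
  define L where "L = ln x"
  have L: "0 < L" using x by (simp add: L_def)
  have lt: "s < t" using False st by simp
  obtain \<xi> where \<xi>: "s < \<xi>" "\<xi> < t" "\<phi> t - \<phi> s = (t - s) * g \<xi>"
  proof -
    have "\<exists>l z. s < z \<and> z < t \<and> DERIV \<phi> z :> l \<and> \<phi> t - \<phi> s = (t - s) * l"
      by (rule MVT[OF lt cont]) (use deriv real_differentiable_def in blast)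
    then obtain l z where z: "s < z" "z < t" "DERIV \<phi> z :> l" "\<phi> t - \<phi> s = (t - s) * l" by blast
    then have "l = g z" using deriv DERIV_unique by blast
    with z that show ?thesis by blast
  qed
  define w where "w = (\<lambda>n. mangoldt n / (real n * L) :: real)"
  have w0: "0 \<le> w n" for n using L by (simp add: w_def mangoldt_nonneg)
  define m where "m = sum w A"
  have "m = (\<Sum>n\<in>A. mangoldt n / real n) / L"
    by (simp add: m_def w_def sum_divide_distrib)
  moreover have "\<bar>(\<Sum>n\<in>A. mangoldt n / real n) - (ln (x powr t) - ln (x powr s))\<bar> \<le> 10"
    unfolding A_def using x st by (intro mertens_first ge_one_powr_ge_zero powr_mono) auto
  moreover have "ln (x powr t) - ln (x powr s) = (t - s) * L"
    using x by (simp add: L_def ln_powr algebra_simps)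
  ultimately have "\<bar>m * L - (t - s) * L\<bar> \<le> 10" using L by simp
  then have "\<bar>m - (t - s)\<bar> * L \<le> 10" using L by (simp add: left_diff_distrib[symmetric] abs_mult)
  then have m: "\<bar>m - (t - s)\<bar> \<le> 10 / L" using L by (simp add: le_divide_eq)
  have dev: "\<bar>g (ln (real n) / L) - g \<xi>\<bar> \<le> \<eta>" if "n \<in> A" for n
  proof -
    have n: "x powr s < real n" "real n \<le> x powr t" using that by (auto simp: A_def nats_between_def)
    have "0 < x powr s" using x by simp
    with n(1) have "0 < real n" by linarith
    then have "ln (x powr s) < ln (real n)" "ln (real n) \<le> ln (x powr t)"
      using n \<open>0 < x powr s\<close> by (simp_all only: ln_less_cancel_iff ln_le_cancel_iff order_less_le_trans)
    then have "s * L < ln (real n)" "ln (real n) \<le> t * L" using x by (auto simp: L_def ln_powr)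
    then have "s \<le> ln (real n) / L" "ln (real n) / L \<le> t" using L by (auto simp: field_simps)
    then show ?thesis using \<xi> by (intro osc) auto
  qed
  have "\<bar>(\<Sum>n\<in>A. w n * g (ln (real n) / L)) - m * g \<xi>\<bar>
      = \<bar>\<Sum>n\<in>A. w n * (g (ln (real n) / L) - g \<xi>)\<bar>"
    by (simp add: m_def sum_distrib_right right_diff_distrib sum_subtractf)
  also have "\<dots> \<le> (\<Sum>n\<in>A. w n * \<eta>)"
    by (rule order_trans[OF sum_abs sum_mono]) (use w0 dev in \<open>auto simp: abs_mult intro!: mult_left_mono\<close>)
  also have "\<dots> = \<eta> * m" by (simp add: m_def sum_distrib_left mult.commute)
  also have "\<dots> \<le> \<eta> * ((t - s) + 10 / L)" using m nonneg by (intro mult_left_mono) auto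
  finally have 1: "\<bar>(\<Sum>n\<in>A. w n * g (ln (real n) / L)) - m * g \<xi>\<bar> \<le> \<eta> * ((t - s) + 10 / L)" .
  have "\<bar>m * g \<xi> - (\<phi> t - \<phi> s)\<bar> = \<bar>m - (t - s)\<bar> * \<bar>g \<xi>\<bar>"
    unfolding \<xi>(3) by (simp add: left_diff_distrib[symmetric] abs_mult)
  also have "\<dots> \<le> 10 / L * B" using m \<xi> L by (intro mult_mono bound) auto
  finally have 2: "\<bar>m * g \<xi> - (\<phi> t - \<phi> s)\<bar> \<le> 10 / L * B" .
  have "\<bar>(\<Sum>n\<in>A. w n * g (ln (real n) / L)) - (\<phi> t - \<phi> s)\<bar> \<le> \<eta> * ((t - s) + 10 / L) + 10 / L * B"
    using 1 2 by linarith
  also have "\<dots> = \<eta> * (t - s) + (\<eta> + B) * (10 / L)" by (simp add: algebra_simps add_divide_distrib)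
  finally show ?thesis by (simp only: A_def w_def L_def)
qed

lemma eventually_le_ln: "\<forall>\<^sub>F x in at_top. c \<le> ln (x::real)"
  using ln_at_top by (simp add: filterlim_at_top)

text \<open>The measures with mass \<open>mangoldt n / (n * ln x)\<close> at \<open>ln n / ln x\<close> converge to Lebesgue measure;
  \<open>\<phi>\<close> plays the role of an antiderivative of \<open>g\<close>.\<close>

lemma mertens_weighted_sum:
  fixes g \<phi> :: "real \<Rightarrow> real"
  assumes \<alpha>: "0 \<le> \<alpha>" "\<alpha> \<le> 1" and g: "continuous_on {\<alpha>..1} g" and \<phi>: "continuous_on {\<alpha>..1} \<phi>"
    and deriv: "\<And>z. \<alpha> < z \<Longrightarrow> z < 1 \<Longrightarrow> (\<phi> has_real_derivative g z) (at z)"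
    and \<epsilon>: "0 < \<epsilon>"
  shows "\<forall>\<^sub>F x in at_top. \<forall>a\<in>{\<alpha>..1}.
    \<bar>(\<Sum>n\<in>nats_between (x powr a) x. mangoldt n / (real n * ln x) * g (ln (real n) / ln x))
      - (\<phi> 1 - \<phi> a)\<bar> \<le> \<epsilon>"
proof -
  have "compact (g ` {\<alpha>..1})" using g by (intro compact_continuous_image) auto
  then obtain B where B: "0 < B" "\<And>z. z \<in> {\<alpha>..1} \<Longrightarrow> \<bar>g z\<bar> \<le> B"
    using bounded_pos[of "g ` {\<alpha>..1}"] compact_imp_bounded by auto
  have "uniformly_continuous_on {\<alpha>..1} g" using g by (intro compact_uniformly_continuous) auto
  then obtain d where d: "0 < d"
    "\<And>z w. z \<in> {\<alpha>..1} \<Longrightarrow> w \<in> {\<alpha>..1} \<Longrightarrow> \<bar>w - z\<bar> < d \<Longrightarrow> \<bar>g w - g z\<bar> < \<epsilon> / 2"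
    using \<epsilon> unfolding uniformly_continuous_on_def dist_real_def by (metis half_gt_zero)
  obtain m where "1 / d < real m" using reals_Archimedean2 by blast
  then have m: "0 < m" "1 / real m < d"
    using d(1) by (auto simp: divide_simps mult.commute intro: gr0I)
  \<comment> \<open>Each of the \<open>m\<close> pieces will have error term
    \<open>(\<epsilon> / 2 + B) * 10 / ln x\<close>; the threshold with 20 makes their sum at most
    \<open>\<epsilon> / 2\<close>. The oscillation accounts for the other half.\<close>
  show ?thesis
    using eventually_gt_at_top[of 1] eventually_le_ln[of "20 * real m * (\<epsilon> / 2 + B) / \<epsilon>"]
  proof eventually_elim
    case (elim x)
    have L: "0 < ln x" using elim by simp
    show ?case
    proof
      fix a assume a: "a \<in> {\<alpha>..1}"
      \<comment> \<open>The number \<open>m\<close> of equal pieces of \<open>[a, 1]\<close> does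
        not depend on \<open>a\<close>; hence one threshold for \<open>x\<close> serves every
        \<open>a\<close>.\<close>
      define t where "t = (\<lambda>j. a + (1 - a) * (real j / real m))"
      have t0: "t 0 = a" and tm: "t m = 1" using m by (auto simp: t_def)
      have tmono: "t i \<le> t j" if "i \<le> j" for i j
        using a that by (auto simp: t_def intro!: mult_left_mono divide_right_mono)
      have trange: "\<alpha> \<le> t j" "t j \<le> 1" if "j \<le> m" for j
        using tmono[of 0 j] tmono[of j m] that t0 tm a by auto
      have tstep: "t (Suc j) - t j = (1 - a) / real m" for j
        using m by (simp add: t_def field_simps)
      have tsmall: "t (Suc j) - t j < d" for j
      proof -
        have "(1 - a) / real m \<le> 1 / real m" using a \<alpha> by (intro divide_right_mono) auto
        then show ?thesis using m(2) tstep[of j] by linarith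
      qed
      define F where "F = (\<lambda>n. mangoldt n / (real n * ln x) * g (ln (real n) / ln x))"
      define E where "E = (\<epsilon> / 2 + B) * (10 / ln x)"
      have piece: "\<bar>sum F (nats_between (x powr t j) (x powr t (Suc j))) - (\<phi> (t (Suc j)) - \<phi> (t j))\<bar>
          \<le> \<epsilon> / 2 * (t (Suc j) - t j) + E" if j: "Suc j \<le> m" for j
        unfolding F_def E_def
      proof (rule mertens_weighted_piece)
        have r: "\<alpha> \<le> t j" "t (Suc j) \<le> 1" using trange[of j] trange[of "Suc j"] j by auto
        show "0 \<le> t j" using r \<alpha> by linarith
        show "t j \<le> t (Suc j)" by (rule tmono) simp
        show "continuous_on {t j..t (Suc j)} \<phi>" by (rule continuous_on_subset[OF \<phi>]) (use r in auto)
        show "\<bar>g z\<bar> \<le> B" if "t j \<le> z" "z \<le> t (Suc j)" for z using that r by (intro B(2)) auto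
        show "\<bar>g z - g w\<bar> \<le> \<epsilon> / 2"
          if "t j \<le> z" "z \<le> t (Suc j)" "t j \<le> w" "w \<le> t (Suc j)" for z w
        proof -
          have "\<bar>z - w\<bar> < d" using tsmall[of j] that by linarith
          then show ?thesis using d(2)[of w z] that r by (intro less_imp_le) auto
        qed
        show "(\<phi> has_real_derivative g z) (at z)" if "t j < z" "z < t (Suc j)" for z
          using that r by (intro deriv) auto
      qed (use elim \<epsilon> B in auto)
      have total: "\<bar>sum F (nats_between (x powr t 0) (x powr t j)) - (\<phi> (t j) - \<phi> (t 0))\<bar>
          \<le> \<epsilon> / 2 * (t j - t 0) + real j * E" if "j \<le> m" for j
        using that
      proof (induction j)
        case 0
        have "nats_between (x powr t 0) (x powr t 0) = {}" by (auto simp: nats_between_def)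
        then show ?case by simp
      next
        case (Suc j)
        have "sum F (nats_between (x powr t 0) (x powr t (Suc j)))
            = sum F (nats_between (x powr t 0) (x powr t j)) + sum F (nats_between (x powr t j) (x powr t (Suc j)))"
          using elim by (intro sum_nats_between_combine powr_mono tmono) auto
        then have "\<bar>sum F (nats_between (x powr t 0) (x powr t (Suc j))) - (\<phi> (t (Suc j)) - \<phi> (t 0))\<bar>
            \<le> (\<epsilon> / 2 * (t j - t 0) + real j * E) + (\<epsilon> / 2 * (t (Suc j) - t j) + E)"
          using Suc.IH Suc.prems piece[of j] by linarith
        also have "\<dots> = \<epsilon> / 2 * (t (Suc j) - t 0) + real (Suc j) * E" by (simp add: field_simps)
        finally show ?case .
      qed
      have "\<bar>sum F (nats_between (x powr a) x) - (\<phi> 1 - \<phi> a)\<bar> \<le> \<epsilon> / 2 * (1 - a) + real m * E"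
        using total[of m] elim by (simp add: t0 tm)
      also have "\<dots> \<le> \<epsilon> / 2 * 1 + \<epsilon> / 2"
      proof (intro add_mono mult_left_mono)
        have "20 * real m * (\<epsilon> / 2 + B) \<le> ln x * \<epsilon>" using elim(2) \<epsilon> by (simp add: divide_le_eq)
        then show "real m * E \<le> \<epsilon> / 2" using L by (simp add: E_def field_simps)
      qed (use a \<alpha> \<epsilon> in auto)
      finally show "\<bar>(\<Sum>n\<in>nats_between (x powr a) x. mangoldt n / (real n * ln x) * g (ln (real n) / ln x))
          - (\<phi> 1 - \<phi> a)\<bar> \<le> \<epsilon>" by (simp add: F_def)
    qed
  qed
qed

text \<open>Uniformity in \<open>y\<close> is uniformity in the left endpoint
  \<open>a = ln y / ln x\<close>. The bound by \<open>K\<close> keeps \<open>a\<close> in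
  \<open>[1 / K, 1]\<close>, away from the singularity at \<open>t = 0\<close>.\<close>

lemma sum_dickman_asymptotic:
  assumes \<rho>: "is_dickman \<rho>" and K: "1 \<le> K" and \<epsilon>: "0 < \<epsilon>"
  shows "\<forall>\<^sub>F x in at_top. \<forall>y\<ge>2. ln y \<le> ln x \<longrightarrow> ln x \<le> K * ln y \<longrightarrow>
    \<bar>(\<Sum>n\<in>nats_between y x. mangoldt n / ln (real n) * (1 / real n * \<rho> (ln x / ln (real n) - 1)))
      - (1 - \<rho> (ln x / ln y))\<bar> \<le> \<epsilon>"
proof -
  define g where "g = (\<lambda>t. \<rho> (1 / t - 1) / t)"
  define \<phi> where "\<phi> = (\<lambda>t. \<rho> (1 / t))"
  have cont: "continuous_on {0..} \<rho>" using \<rho> by (simp add: is_dickman_def)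
  have K0: "0 < 1 / K" "1 / K \<le> 1" using K by auto
  have "\<forall>\<^sub>F x in at_top. \<forall>a\<in>{1 / K..1}.
    \<bar>(\<Sum>n\<in>nats_between (x powr a) x. mangoldt n / (real n * ln x) * g (ln (real n) / ln x))
      - (\<phi> 1 - \<phi> a)\<bar> \<le> \<epsilon>"
  proof (rule mertens_weighted_sum)
    show "continuous_on {1 / K..1} g" unfolding g_def
    proof (intro continuous_on_divide continuous_on_compose2[OF cont])
      show "(\<lambda>t. 1 / t - 1) ` {1 / K..1} \<subseteq> {0..}"
      proof clarsimp
        fix t assume t: "1 / K \<le> t" "t \<le> 1"
        then have "0 < t" using K0 by linarith
        with t show "1 \<le> 1 / t" by simp
      qed
    qed (use K0 in \<open>auto intro!: continuous_intros\<close>)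
    show "continuous_on {1 / K..1} \<phi>" unfolding \<phi>_def
    proof (intro continuous_on_compose2[OF cont])
      show "(\<lambda>t. 1 / t) ` {1 / K..1} \<subseteq> {0..}"
      proof clarsimp
        fix t assume "1 / K \<le> t"
        with K0 show "0 \<le> t" by linarith
      qed
    qed (use K0 in \<open>auto intro!: continuous_intros\<close>)
    fix t assume t: "1 / K < t" "t < 1"
    then have t0: "0 < t" using K0 by linarith
    have "((\<lambda>t. 1 / t) has_real_derivative - 1 / t ^ 2) (at t)"
      using t0 by (auto intro!: derivative_eq_intros simp: power2_eq_square)
    moreover have "(\<rho> has_real_derivative - \<rho> (1 / t - 1) / (1 / t)) (at (1 / t))"
      using t t0 by (intro dickman_DERIV[OF \<rho>]) simp
    ultimately have "(\<phi> has_real_derivative (- \<rho> (1 / t - 1) / (1 / t)) * (- 1 / t ^ 2)) (at t)"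
      unfolding \<phi>_def by (intro DERIV_chain2)
    moreover have "(- \<rho> (1 / t - 1) / (1 / t)) * (- 1 / t ^ 2) = g t"
      using t0 by (simp add: g_def power2_eq_square)
    ultimately show "(\<phi> has_real_derivative g t) (at t)" by simp
  qed (use K0 \<epsilon> in auto)
  then show ?thesis
    using eventually_gt_at_top[of 1]
  proof eventually_elim
    case (elim x)
    have L: "0 < ln x" using elim by simp
    show ?case
    proof (intro allI impI)
      fix y :: real assume y: "2 \<le> y" "ln y \<le> ln x" "ln x \<le> K * ln y"
      define a where "a = ln y / ln x"
      have ly: "0 < ln y" using y by simp
      have a: "a \<in> {1 / K..1}" using y L K by (auto simp: a_def field_simps)
      have pow: "x powr a = y" using L y elim by (simp add: a_def powr_def)
      have \<phi>: "\<phi> 1 = 1" "\<phi> a = \<rho> (ln x / ln y)" using \<rho> by (auto simp: \<phi>_def a_def is_dickman_def)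
      have sum: "(\<Sum>n\<in>nats_between y x. mangoldt n / (real n * ln x) * g (ln (real n) / ln x))
        = (\<Sum>n\<in>nats_between y x. mangoldt n / ln (real n) * (1 / real n * \<rho> (ln x / ln (real n) - 1)))"
      proof (rule sum.cong[OF refl])
        fix n assume "n \<in> nats_between y x"
        then have "0 < ln (real n)" "0 < real n" using y by (auto simp: nats_between_def)
        then show "mangoldt n / (real n * ln x) * g (ln (real n) / ln x)
          = mangoldt n / ln (real n) * (1 / real n * \<rho> (ln x / ln (real n) - 1))"
          using L by (simp add: g_def field_simps)
      qed
      show "\<bar>(\<Sum>n\<in>nats_between y x. mangoldt n / ln (real n) * (1 / real n * \<rho> (ln x / ln (real n) - 1)))
          - (1 - \<rho> (ln x / ln y))\<bar> \<le> \<epsilon>"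
        using bspec[OF elim(1) a] unfolding pow \<phi> sum .
    qed
  qed
qed

text \<open>The weight \<open>mangoldt n / ln n\<close> is 1 at primes, so only the proper prime powers contribute
  to the difference.\<close>

lemma sum_primepows_approx:
  assumes "0 < \<epsilon>"
  obtains Y where "\<And>x y B f. Y \<le> y \<Longrightarrow> 2 \<le> y \<Longrightarrow> 0 \<le> B \<Longrightarrow>
      (\<And>n. n \<in> nats_between y x \<Longrightarrow> 0 \<le> f n \<and> f n \<le> B / real n) \<Longrightarrow>
      \<bar>(\<Sum>q\<in>primepows_between y x. f q) - (\<Sum>n\<in>nats_between y x. mangoldt n / ln (real n) * f n)\<bar> \<le> B * \<epsilon>"
proof -
  obtain Y where Y: "\<And>F. finite F \<Longrightarrow> F \<subseteq> proper_primepows \<Longrightarrow> (\<forall>q\<in>F. real q > Y)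
    \<Longrightarrow> (\<Sum>q\<in>F. 1 / real q) \<le> \<epsilon>"
    using proper_primepows_tail[OF assms] by blast
  show ?thesis
  proof (rule that[of Y])
    fix x y B :: real and f :: "nat \<Rightarrow> real"
    assume y: "Y \<le> y" "2 \<le> y" and B: "0 \<le> B"
      and f: "\<And>n. n \<in> nats_between y x \<Longrightarrow> 0 \<le> f n \<and> f n \<le> B / real n"
    define P where "P = primepows_between y x"
    define \<theta> where "\<theta> = (\<lambda>n. mangoldt n / ln (real n) :: real)"
    have P: "n \<in> nats_between y x" "primepow n" "0 < real n" "0 < ln (real n)" if "n \<in> P" for n
      using that y by (auto simp: P_def primepows_between_def nats_between_def)
    have "(\<Sum>n\<in>nats_between y x. \<theta> n * f n) = (\<Sum>n\<in>P. \<theta> n * f n)"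
      by (rule sum.mono_neutral_right) (auto simp: P_def primepows_between_def \<theta>_def mangoldt_def)
    then have "\<bar>(\<Sum>q\<in>P. f q) - (\<Sum>n\<in>nats_between y x. \<theta> n * f n)\<bar> = \<bar>\<Sum>q\<in>P. (1 - \<theta> q) * f q\<bar>"
      by (simp add: left_diff_distrib sum_subtractf)
    also have "(\<Sum>q\<in>P. (1 - \<theta> q) * f q) = (\<Sum>q\<in>P \<inter> proper_primepows. (1 - \<theta> q) * f q)"
    proof (rule sum.mono_neutral_right)
      show "\<forall>q\<in>P - P \<inter> proper_primepows. (1 - \<theta> q) * f q = 0"
      proof
        fix q assume "q \<in> P - P \<inter> proper_primepows"
        then have "q \<in> P" "prime q" using P(2) by (auto simp: proper_primepows_def)
        then show "(1 - \<theta> q) * f q = 0" using P(4)[of q] by (simp add: \<theta>_def)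
      qed
    qed (auto simp: P_def)
    also have "\<bar>\<dots>\<bar> \<le> (\<Sum>q\<in>P \<inter> proper_primepows. B * (1 / real q))"
    proof (rule order_trans[OF sum_abs sum_mono])
      fix q assume "q \<in> P \<inter> proper_primepows"
      then have q: "q \<in> P" by simp
      \<comment> \<open>The weight therefore lies between 0 and 1, so each proper prime power
        contributes at most \<open>B / q\<close> to the difference.\<close>
      have "mangoldt q \<le> ln (real q)" using P(3)[OF q] by (intro mangoldt_le) simp
      then have "0 \<le> \<theta> q" "\<theta> q \<le> 1"
        using P(4)[OF q] mangoldt_nonneg[of q] by (auto simp: \<theta>_def divide_le_eq)
      then have "\<bar>(1 - \<theta> q) * f q\<bar> \<le> 1 * (B / real q)"
        unfolding abs_mult using f[OF P(1)[OF q]] by (intro mult_mono) auto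
      then show "\<bar>(1 - \<theta> q) * f q\<bar> \<le> B * (1 / real q)" by simp
    qed
    also have "\<dots> = B * (\<Sum>q\<in>P \<inter> proper_primepows. 1 / real q)" by (simp add: sum_distrib_left)
    also have "\<dots> \<le> B * \<epsilon>"
    proof (intro mult_left_mono Y B)
      show "\<forall>q\<in>P \<inter> proper_primepows. Y < real q"
        using y by (auto simp: P_def primepows_between_def nats_between_def)
    qed (auto simp: P_def)
    finally show "\<bar>(\<Sum>q\<in>primepows_between y x. f q)
        - (\<Sum>n\<in>nats_between y x. mangoldt n / ln (real n) * f n)\<bar> \<le> B * \<epsilon>"
      by (simp add: P_def \<theta>_def)
  qed
qed

section \<open>Smooth abelian groups\<close>

definition smooth_count :: "real \<Rightarrow> real \<Rightarrow> real" where
  "smooth_count x y = real (card (smooth_msets x y))"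

text \<open>The condition says \<open>u \<le> k\<close>, with all \<open>y > x\<close> included. The
  error is absolute, so that errors for \<open>x / q\<close> add up to a multiple of
  \<open>x\<close>.\<close>

definition smooth_asymptotic :: "(real \<Rightarrow> real) \<Rightarrow> real \<Rightarrow> bool" where
  "smooth_asymptotic \<rho> k \<longleftrightarrow> (\<forall>\<epsilon>>0. \<forall>\<^sub>F x in at_top. \<forall>y\<ge>2. ln x \<le> k * ln y \<longrightarrow>
     \<bar>smooth_count x y - erdos_szekeres_const * x * \<rho> (ln x / ln y)\<bar> \<le> \<epsilon> * x)"

lemma one_le_erdos_szekeres_const: "1 \<le> erdos_szekeres_const"
  using one_le_zeta_prod[of 0] zeta_prod_le[of 0] by linarith

lemma smooth_count_nonneg: "0 \<le> smooth_count x y"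
  by (simp add: smooth_count_def)

lemma smooth_count_le:
  assumes "0 \<le> x"
  shows "smooth_count x y \<le> erdos_szekeres_const * x"
proof -
  have "card (smooth_msets x y) \<le> card (smooth_msets x x)"
    by (intro card_mono smooth_msets_subset) auto
  then have "smooth_count x y \<le> real (card (smooth_msets x x))" by (simp add: smooth_count_def)
  also have "\<dots> \<le> erdos_szekeres_const * x" by (rule card_smooth_msets_le[OF assms])
  finally show ?thesis .
qed

lemma smooth_count_self_asymptotic:
  assumes "0 < \<epsilon>"
  shows "\<forall>\<^sub>F x in at_top. \<bar>smooth_count x x - erdos_szekeres_const * x\<bar> \<le> \<epsilon> * x"
  using tendstoD[OF card_smooth_msets_asymptotic assms] eventually_gt_at_top[of 0]
proof eventually_elim
  case (elim x)
  have "\<bar>smooth_count x x / x - erdos_szekeres_const\<bar> * x \<le> \<epsilon> * x"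
    using elim unfolding smooth_count_def dist_real_def by (intro mult_right_mono) auto
  moreover have "\<bar>smooth_count x x / x - erdos_szekeres_const\<bar> * x = \<bar>(smooth_count x x / x - erdos_szekeres_const) * x\<bar>"
    using elim by (simp add: abs_mult)
  moreover have "(smooth_count x x / x - erdos_szekeres_const) * x = smooth_count x x - erdos_szekeres_const * x"
    using elim by (simp add: field_simps)
  ultimately show ?case by simp
qed

lemma smooth_asymptotic_1:
  assumes "is_dickman \<rho>"
  shows "smooth_asymptotic \<rho> 1"
  unfolding smooth_asymptotic_def
proof (intro allI impI)
  fix \<epsilon> :: real assume "0 < \<epsilon>"
  from smooth_count_self_asymptotic[OF this] eventually_gt_at_top[of 1]
  show "\<forall>\<^sub>F x in at_top. \<forall>y\<ge>2. ln x \<le> 1 * ln y \<longrightarrow>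
     \<bar>smooth_count x y - erdos_szekeres_const * x * \<rho> (ln x / ln y)\<bar> \<le> \<epsilon> * x"
  proof eventually_elim
    case (elim x)
    show ?case
    proof (intro allI impI)
      fix y :: real assume y: "2 \<le> y" "ln x \<le> 1 * ln y"
      then have "x \<le> y" using elim by simp
      then have "smooth_count x y = smooth_count x x"
        by (simp only: smooth_count_def smooth_msets_ge_eq[of x y])
      moreover have "\<rho> (ln x / ln y) = 1"
        using assms y elim by (auto simp: is_dickman_def)
      ultimately show "\<bar>smooth_count x y - erdos_szekeres_const * x * \<rho> (ln x / ln y)\<bar> \<le> \<epsilon> * x"
        using elim(1) by simp
    qed
  qed
qed

lemma dickman_bounded:
  assumes "is_dickman \<rho>"
  obtains B where "0 < B" "\<And>u. 0 \<le> u \<Longrightarrow> u \<le> k \<Longrightarrow> \<bar>\<rho> u\<bar> \<le> B"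
proof -
  have "compact (\<rho> ` {0..k})"
    using assms by (intro compact_continuous_image) (auto simp: is_dickman_def intro: continuous_on_subset)
  then show ?thesis
    using that bounded_pos[of "\<rho> ` {0..k}"] compact_imp_bounded by auto
qed

text \<open>The hypothesis for \<open>k\<close> fits the pair \<open>(x / n, n)\<close>, since
  \<open>ln (x / n) \<le> k * ln n\<close> is the same as \<open>ln x \<le> (k + 1) * ln n\<close>,
  but only while \<open>x / n\<close> is large. For \<open>n\<close> above \<open>x / X0\<close> a
  trivial bound is enough: the sum of \<open>mangoldt n / n\<close> there is at most
  \<open>ln X0 + 10\<close>, and the weight supplies a factor of order
  \<open>1 / ln x\<close>.\<close>

lemma sum_smooth_count_approx:
  assumes \<rho>: "is_dickman \<rho>" and k: "1 \<le> k" and IH: "smooth_asymptotic \<rho> k" and \<epsilon>: "0 < \<epsilon>"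
  shows "\<forall>\<^sub>F x in at_top. \<forall>y\<ge>2. ln y \<le> ln x \<longrightarrow> ln x \<le> (k + 1) * ln y \<longrightarrow>
    \<bar>\<Sum>n\<in>nats_between y x. mangoldt n / ln (real n) * (smooth_count (x / real n) (real n)
       - erdos_szekeres_const * (x / real n) * \<rho> (ln x / ln (real n) - 1))\<bar> \<le> \<epsilon> * x"
proof -
  let ?C = erdos_szekeres_const
  note C = one_le_erdos_szekeres_const
  obtain B where B: "0 < B" "\<And>u. 0 \<le> u \<Longrightarrow> u \<le> k \<Longrightarrow> \<bar>\<rho> u\<bar> \<le> B"
    using dickman_bounded[OF \<rho>] by blast
  \<comment> \<open>The trivial bound for the difference, per unit of \<open>x / n\<close>:
    \<open>?C\<close> from the count and \<open>?C * B\<close> from the term with \<rho>.\<close>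
  define D where "D = ?C * (1 + B)"
  have D: "0 < D" using B C by (simp add: D_def)
  \<comment> \<open>The weights contribute \<open>(k + 1) / L\<close> and the Mertens sum at most
    \<open>2 * L\<close>, so this choice leaves exactly \<open>\<epsilon> / 2\<close>.\<close>
  define \<epsilon>' where "\<epsilon>' = \<epsilon> / (4 * (k + 1))"
  have \<epsilon>': "0 < \<epsilon>'" using \<epsilon> k by (simp add: \<epsilon>'_def)
  obtain X1 where X1: "\<And>x y. X1 \<le> x \<Longrightarrow> 2 \<le> y \<Longrightarrow> ln x \<le> k * ln y \<Longrightarrow>
     \<bar>smooth_count x y - ?C * x * \<rho> (ln x / ln y)\<bar> \<le> \<epsilon>' * x"
    using IH \<epsilon>' unfolding smooth_asymptotic_def eventually_at_top_linorder by blast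
  define X0 where "X0 = max X1 1"
  have X0: "1 \<le> X0" "X1 \<le> X0" by (auto simp: X0_def)
  \<comment> \<open>\<open>ln x \<ge> 10\<close> absorbs the constant of Mertens' theorem into
    \<open>2 * ln x\<close>; the last threshold makes the contribution of \<open>n > x / X0\<close>
    at most \<open>\<epsilon> / 2 * x\<close>.\<close>
  show ?thesis
    using eventually_ge_at_top[of X0] eventually_le_ln[of 10]
      eventually_le_ln[of "2 * D * (k + 1) * (ln X0 + 10) / \<epsilon>"]
  proof eventually_elim
    case (elim x)
    define L where "L = ln x"
    have L: "10 \<le> L" "2 * D * (k + 1) * (ln X0 + 10) \<le> \<epsilon> * L"
      using elim \<epsilon> by (auto simp: L_def divide_le_eq mult.commute)
    have x: "1 \<le> x" using elim X0 by linarith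
    show ?case
    proof (intro allI impI)
      fix y :: real assume y: "2 \<le> y" "ln y \<le> ln x" "ln x \<le> (k + 1) * ln y"
      have yx: "y \<le> x" using y x by simp
      have ly: "0 < ln y" using y by simp
      \<comment> \<open>The \<open>n\<close> with \<open>x / n < X0\<close>, where the induction
        hypothesis may fail to apply.\<close>
      define big where "big = nats_between (x / X0) x"
      have term_le: "\<bar>mangoldt n / ln (real n) * (smooth_count (x / real n) (real n)
          - ?C * (x / real n) * \<rho> (ln x / ln (real n) - 1))\<bar>
          \<le> (k + 1) / L * x * (\<epsilon>' * (mangoldt n / real n) + D * (if n \<in> big then mangoldt n / real n else 0))"
        if n: "n \<in> nats_between y x" for n
      proof -
        have n1: "y < real n" "real n \<le> x" using n by (auto simp: nats_between_def)
        have n0: "0 < real n" using n1 y by linarith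
        have lny: "ln y \<le> ln (real n)" using n1 y by simp
        then have ln0: "0 < ln (real n)" using ly by linarith
        have "ln x \<le> (k + 1) * ln (real n)"
          using y(3) mult_left_mono[OF lny, of "k + 1"] k by linarith
        then have w: "1 / ln (real n) \<le> (k + 1) / L" using ln0 L by (simp add: L_def field_simps)
        have lnx: "ln (x / real n) = ln x - ln (real n)" using x n0 by (simp add: ln_div)
        have v: "ln x / ln (real n) - 1 = ln (x / real n) / ln (real n)"
          using ln0 by (simp add: lnx field_simps)
        have vk: "ln (x / real n) \<le> k * ln (real n)"
          using \<open>ln x \<le> (k + 1) * ln (real n)\<close> by (simp add: lnx algebra_simps)
        have v0: "0 \<le> ln (x / real n)" using n1 n0 by (simp add: lnx)
        define T where "T = smooth_count (x / real n) (real n)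
          - ?C * (x / real n) * \<rho> (ln x / ln (real n) - 1)"
        have T: "\<bar>T\<bar> \<le> (x / real n) * (\<epsilon>' + (if n \<in> big then D else 0))"
        proof (cases "n \<in> big")
          case True
          have "\<bar>\<rho> (ln x / ln (real n) - 1)\<bar> \<le> B"
            unfolding v using v0 vk ln0 by (intro B) (auto simp: divide_le_eq)
          then have "\<bar>?C * (x / real n) * \<rho> (ln x / ln (real n) - 1)\<bar> \<le> ?C * (x / real n) * B"
            using C x n0 unfolding abs_mult by (intro mult_mono) auto
          moreover have "smooth_count (x / real n) (real n) \<le> ?C * (x / real n)"
            using x n0 by (intro smooth_count_le) simp
          ultimately have "\<bar>T\<bar> \<le> ?C * (x / real n) * B + ?C * (x / real n)"
            unfolding T_def using smooth_count_nonneg[of "x / real n" "real n"] by linarith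
          also have "\<dots> = (x / real n) * D" by (simp add: D_def algebra_simps)
          also have "\<dots> \<le> (x / real n) * (\<epsilon>' + D)"
            using x n0 \<epsilon>' by (intro mult_left_mono) auto
          finally show ?thesis using True by simp
        next
          case False
          then have "real n \<le> x / X0" using n1 by (auto simp: big_def nats_between_def)
          then have "X0 * real n \<le> x" using X0 by (simp add: field_simps)
          then have "X1 * real n \<le> x" using mult_right_mono[OF X0(2), of "real n"] by linarith
          then have "X1 \<le> x / real n" using n0 by (simp add: le_divide_eq)
          then have "\<bar>T\<bar> \<le> \<epsilon>' * (x / real n)"
            unfolding T_def v using n1 y vk by (intro X1) auto
          with False show ?thesis by (simp add: mult.commute)
        qed
        have "\<bar>mangoldt n / ln (real n) * T\<bar> = mangoldt n * (1 / ln (real n)) * \<bar>T\<bar>"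
          using ln0 by (simp add: abs_mult)
        also have "\<dots> \<le> mangoldt n * ((k + 1) / L) * ((x / real n) * (\<epsilon>' + (if n \<in> big then D else 0)))"
          using w T k L mangoldt_nonneg[of n] by (intro mult_mono mult_left_mono) auto
        also have "\<dots> = (k + 1) / L * x * (\<epsilon>' * (mangoldt n / real n) + D * (if n \<in> big then mangoldt n / real n else 0))"
        proof -
          have "a * K * (x / b * (e + d)) = K * x * (e * (a / b) + d * (a / b))" for a K b e d :: real
            by (simp add: algebra_simps add_divide_distrib)
          moreover have "D * (if n \<in> big then a else 0) = (if n \<in> big then D else 0) * a" for a
            by simp
          ultimately show ?thesis by (simp only:)
        qed
        finally show ?thesis by (simp only: T_def)
      qed
      have "\<bar>\<Sum>n\<in>nats_between y x. mangoldt n / ln (real n) * (smooth_count (x / real n) (real n)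
          - ?C * (x / real n) * \<rho> (ln x / ln (real n) - 1))\<bar>
        \<le> (\<Sum>n\<in>nats_between y x. (k + 1) / L * x *
            (\<epsilon>' * (mangoldt n / real n) + D * (if n \<in> big then mangoldt n / real n else 0)))"
        by (rule order_trans[OF sum_abs sum_mono[OF term_le]])
      also have "\<dots> = (k + 1) / L * x * (\<epsilon>' * (\<Sum>n\<in>nats_between y x. mangoldt n / real n)
          + D * (\<Sum>n\<in>nats_between y x. if n \<in> big then mangoldt n / real n else 0))"
        by (simp only: sum_distrib_left[symmetric] sum.distrib)
      also have "\<dots> \<le> (k + 1) / L * x * (\<epsilon>' * (2 * L) + D * (ln X0 + 10))"
      proof (intro mult_left_mono add_mono)
        have "(\<Sum>n\<in>nats_between y x. mangoldt n / real n) \<le> ln x - ln y + 10"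
          using mertens_first[of y x] y yx by linarith
        then show "(\<Sum>n\<in>nats_between y x. mangoldt n / real n) \<le> 2 * L"
          using L ly by (simp add: L_def)
        have "(\<Sum>n\<in>nats_between y x. if n \<in> big then mangoldt n / real n else 0)
            = (\<Sum>n\<in>nats_between y x \<inter> big. mangoldt n / real n :: real)"
          by (simp add: sum.inter_restrict)
        also have "\<dots> \<le> (\<Sum>n\<in>big. mangoldt n / real n)"
          by (intro sum_mono2) (auto simp: big_def mangoldt_nonneg)
        also have "\<dots> \<le> ln x - ln (x / X0) + 10"
          using mertens_first[of "x / X0" x] elim X0 x unfolding big_def by (simp add: field_simps abs_le_iff)
        also have "\<dots> = ln X0 + 10" using X0 x by (simp add: ln_div)
        finally show "(\<Sum>n\<in>nats_between y x. if n \<in> big then mangoldt n / real n else 0) \<le> ln X0 + 10" .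
      qed (use k L x \<epsilon>' D in auto)
      also have "\<dots> = (\<epsilon> / 2 + (k + 1) * D * (ln X0 + 10) / L) * x"
      proof -
        have "K / L * x * (\<epsilon>' * (2 * L) + D * W) = (2 * (K * \<epsilon>') + K * D * W / L) * x" for K W
          using L by (simp add: field_simps)
        moreover have "2 * (K * (\<epsilon> / (4 * K))) = \<epsilon> / 2" if "1 \<le> K" for K
          using that by simp
        then have "2 * ((k + 1) * \<epsilon>') = \<epsilon> / 2" unfolding \<epsilon>'_def using k by (metis add_increasing2 zero_le_one)
        ultimately show ?thesis by (simp only:)
      qed
      also have "\<dots> \<le> (\<epsilon> / 2 + \<epsilon> / 2) * x"
        using L x by (intro mult_right_mono add_left_mono) (auto simp: divide_le_eq algebra_simps)
      finally show "\<bar>\<Sum>n\<in>nats_between y x. mangoldt n / ln (real n) * (smooth_count (x / real n) (real n)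
          - ?C * (x / real n) * \<rho> (ln x / ln (real n) - 1))\<bar> \<le> \<epsilon> * x" by simp
    qed
  qed
qed

lemma smooth_asymptotic_step:
  assumes \<rho>: "is_dickman \<rho>" and k: "1 \<le> k" and IH: "smooth_asymptotic \<rho> k"
  shows "smooth_asymptotic \<rho> (k + 1)"
  unfolding smooth_asymptotic_def
proof (intro allI impI)
  fix \<epsilon> :: real assume \<epsilon>: "0 < \<epsilon>"
  let ?C = erdos_szekeres_const
  note C = one_le_erdos_szekeres_const
  \<comment> \<open>Four errors must each be at most \<open>\<epsilon> / 4 * x\<close>. Two of them
    arrive as \<open>?C * x * \<delta>\<close> and two as \<open>\<delta> * x\<close>; since
    \<open>?C \<ge> 1\<close>, this choice suits both.\<close>
  define \<delta> where "\<delta> = \<epsilon> / (4 * ?C)"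
  have \<delta>: "0 < \<delta>" "?C * \<delta> = \<epsilon> / 4" "\<delta> \<le> \<epsilon> / 4"
    using C \<epsilon> by (auto simp: \<delta>_def field_simps)
  obtain Y where Y: "\<And>x y B f. Y \<le> y \<Longrightarrow> 2 \<le> y \<Longrightarrow> 0 \<le> B \<Longrightarrow>
      (\<And>n. n \<in> nats_between y x \<Longrightarrow> 0 \<le> f n \<and> f n \<le> B / real n) \<Longrightarrow>
      \<bar>(\<Sum>q\<in>primepows_between y x. f q) - (\<Sum>n\<in>nats_between y x. mangoldt n / ln (real n) * f n)\<bar> \<le> B * \<delta>"
    using sum_primepows_approx[OF \<delta>(1)] by blast
  have k1: "1 \<le> k + 1" using k by simp
  have IH': "\<forall>\<^sub>F x in at_top. \<forall>y\<ge>2. ln x \<le> k * ln y \<longrightarrow>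
     \<bar>smooth_count x y - ?C * x * \<rho> (ln x / ln y)\<bar> \<le> \<epsilon> * x"
    using IH \<epsilon> by (simp add: smooth_asymptotic_def)
  show "\<forall>\<^sub>F x in at_top. \<forall>y\<ge>2. ln x \<le> (k + 1) * ln y \<longrightarrow>
     \<bar>smooth_count x y - ?C * x * \<rho> (ln x / ln y)\<bar> \<le> \<epsilon> * x"
    using IH' sum_smooth_count_approx[OF \<rho> k IH \<delta>(1)] sum_dickman_asymptotic[OF \<rho> k1 \<delta>(1)]
      smooth_count_self_asymptotic[OF \<delta>(1)] eventually_gt_at_top[of 1]
      eventually_le_ln[of "(k + 1) * ln (max Y 1)"]
  proof eventually_elim
    case (elim x)
    show ?case
    proof (intro allI impI)
      fix y :: real assume y: "2 \<le> y" "ln x \<le> (k + 1) * ln y"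
      have ly: "0 < ln y" using y by simp
      show "\<bar>smooth_count x y - ?C * x * \<rho> (ln x / ln y)\<bar> \<le> \<epsilon> * x"
      proof (cases "ln x \<le> ln y")
        case True
        \<comment> \<open>Here \<open>y \<ge> x\<close>; as \<open>k \<ge> 1\<close>, this range is
          covered by the hypothesis for \<open>k\<close>, so Buchstab's identity is applied only for
          \<open>y < x\<close>.\<close>
        then have "ln x \<le> k * ln y" using mult_right_mono[OF k, of "ln y"] ly by linarith
        with elim(1) y show ?thesis by blast
      next
        case False
        then have yx: "ln y \<le> ln x" by simp
        \<comment> \<open>Bounded \<open>u\<close> forces \<open>y\<close> to grow with
          \<open>x\<close>, so \<open>y\<close> passes the threshold \<open>Y\<close> beyond which
          proper prime powers are negligible.\<close>
        have "(k + 1) * ln (max Y 1) \<le> (k + 1) * ln y" using elim(6) y(2) by linarith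
        then have "ln (max Y 1) \<le> ln y" using k by simp
        then have Yy: "Y \<le> y" using y by simp
        define f where "f = (\<lambda>n::nat. smooth_count (x / real n) (real n))"
        define \<theta> where "\<theta> = (\<lambda>n. mangoldt n / ln (real n) :: real)"
        define r where "r = (\<lambda>n::nat. \<rho> (ln x / ln (real n) - 1))"
        define S where "S = (\<Sum>n\<in>nats_between y x. \<theta> n * f n)"
        define R where "R = (\<Sum>n\<in>nats_between y x. \<theta> n * (1 / real n * r n))"
        have x: "0 < x" using elim by simp
        have "?C * x * \<delta> = ?C * \<delta> * x" by (simp only: mult_ac)
        then have Cx: "?C * x * \<delta> = \<epsilon> / 4 * x" by (simp only: \<delta>(2))
        have buch: "smooth_count x x = smooth_count x y + (\<Sum>q\<in>primepows_between y x. f q)"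
          by (simp add: smooth_count_def f_def buchstab_identity[of x y])
        have "\<bar>(\<Sum>q\<in>primepows_between y x. f q) - S\<bar> \<le> (?C * x) * \<delta>"
          unfolding S_def \<theta>_def
        proof (rule Y[OF Yy y(1)])
          fix n
          show "0 \<le> f n \<and> f n \<le> ?C * x / real n"
            using smooth_count_le[of "x / real n" "real n"] x by (simp add: f_def smooth_count_nonneg)
        qed (use C x in simp)
        then have 1: "\<bar>(\<Sum>q\<in>primepows_between y x. f q) - S\<bar> \<le> \<epsilon> / 4 * x"
          by (simp only: Cx)
        have "S - ?C * x * R = (\<Sum>n\<in>nats_between y x. \<theta> n * (f n - ?C * (x / real n) * r n))"
          by (simp add: S_def R_def right_diff_distrib sum_subtractf sum_distrib_left mult_ac)
        then have "\<bar>S - ?C * x * R\<bar> \<le> \<delta> * x"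
          using elim(2) y yx by (simp add: f_def \<theta>_def r_def)
        also have "\<dots> \<le> \<epsilon> / 4 * x" using \<delta>(3) x by (intro mult_right_mono) auto
        finally have 2: "\<bar>S - ?C * x * R\<bar> \<le> \<epsilon> / 4 * x" .
        have "\<bar>R - (1 - \<rho> (ln x / ln y))\<bar> \<le> \<delta>"
          using elim(3) y yx by (simp add: R_def \<theta>_def r_def)
        then have "?C * x * \<bar>R - (1 - \<rho> (ln x / ln y))\<bar> \<le> ?C * x * \<delta>"
          using C x by (intro mult_left_mono) auto
        moreover have "?C * x * \<bar>R - (1 - \<rho> (ln x / ln y))\<bar> = \<bar>?C * x * (R - (1 - \<rho> (ln x / ln y)))\<bar>"
          using C x by (simp add: abs_mult)
        ultimately have 3: "\<bar>?C * x * R - (?C * x - ?C * x * \<rho> (ln x / ln y))\<bar> \<le> \<epsilon> / 4 * x"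
          unfolding Cx by (simp add: algebra_simps)
        have "\<bar>smooth_count x x - ?C * x\<bar> \<le> \<delta> * x" by (rule elim(4))
        also have "\<dots> \<le> \<epsilon> / 4 * x" using \<delta>(3) x by (intro mult_right_mono) auto
        finally have 4: "\<bar>smooth_count x x - ?C * x\<bar> \<le> \<epsilon> / 4 * x" .
        \<comment> \<open>The main terms combine to
          \<open>?C * x - ?C * x * (1 - \<rho> u) = ?C * x * \<rho> u\<close> with
          \<open>u = ln x / ln y\<close>, up to four errors of
          \<open>\<epsilon> / 4 * x\<close>.\<close>
        show ?thesis using buch 1 2 3 4 by linarith
      qed
    qed
  qed
qed

lemma smooth_asymptotic_Suc:
  assumes "is_dickman \<rho>"
  shows "smooth_asymptotic \<rho> (real (Suc k))"
proof (induction k)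
  case (Suc k)
  then show ?case using smooth_asymptotic_step[OF assms _ Suc] by (simp add: add.commute)
qed (simp add: smooth_asymptotic_1[OF assms])

text \<open>The absolute error becomes relative because the continuous function \<rho> attains a
  positive minimum \<open>\<rho> w\<close> on \<open>[0, U]\<close>: the asymptotic is applied with
  the error \<open>\<epsilon> * erdos_szekeres_const * \<rho> w\<close>.\<close>

theorem mainTheorem2:
  fixes \<rho> :: "real \<Rightarrow> real" and U :: real
  assumes "is_dickman \<rho>" and "U > 0"
  shows "\<forall>\<epsilon>>0. \<forall>\<^sub>F x in at_top. \<forall>y\<ge>2. \<forall>u. u = ln x / ln y \<and> 0 < u \<and> u \<le> U \<longrightarrow>
           (\<exists>\<delta>. \<bar>\<delta>\<bar> \<le> \<epsilon> \<and>
             real (Psi_Gab x y) = (1 + \<delta>) * (\<Prod>r. zeta (real (r + 2))) * x * \<rho> u)"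
proof (intro allI impI)
  fix \<epsilon> :: real assume \<epsilon>: "0 < \<epsilon>"
  let ?C = erdos_szekeres_const
  note C = one_le_erdos_szekeres_const
  have "continuous_on {0..U} \<rho>" using assms(1) by (auto simp: is_dickman_def intro: continuous_on_subset)
  then obtain w where w: "w \<in> {0..U}" "\<And>u. u \<in> {0..U} \<Longrightarrow> \<rho> w \<le> \<rho> u"
    using continuous_attains_inf[of "{0..U}" \<rho>] assms(2) by auto
  have m: "0 < \<rho> w" using dickman_pos[OF assms(1)] w(1) by simp
  define k where "k = nat \<lceil>U\<rceil>"
  have k: "U \<le> real (Suc k)" unfolding k_def by linarith
  have "0 < \<epsilon> * ?C * \<rho> w" using \<epsilon> C m by simp
  then have "\<forall>\<^sub>F x in at_top. \<forall>y\<ge>2. ln x \<le> real (Suc k) * ln y \<longrightarrow>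
     \<bar>smooth_count x y - ?C * x * \<rho> (ln x / ln y)\<bar> \<le> \<epsilon> * ?C * \<rho> w * x"
    using smooth_asymptotic_Suc[OF assms(1), of k] unfolding smooth_asymptotic_def by blast
  then show "\<forall>\<^sub>F x in at_top. \<forall>y\<ge>2. \<forall>u. u = ln x / ln y \<and> 0 < u \<and> u \<le> U \<longrightarrow>
           (\<exists>\<delta>. \<bar>\<delta>\<bar> \<le> \<epsilon> \<and> real (Psi_Gab x y) = (1 + \<delta>) * ?C * x * \<rho> u)"
    using eventually_gt_at_top[of 1]
  proof eventually_elim
    case (elim x)
    show ?case
    proof (intro allI impI)
      fix y u :: real assume y: "2 \<le> y" and u: "u = ln x / ln y \<and> 0 < u \<and> u \<le> U"
      have ly: "0 < ln y" using y by simp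
      have "ln x = u * ln y" using u ly by simp
      also have "\<dots> \<le> real (Suc k) * ln y" using u k ly by (intro mult_right_mono) auto
      finally have "\<bar>smooth_count x y - ?C * x * \<rho> u\<bar> \<le> \<epsilon> * ?C * \<rho> w * x"
        using elim(1) y u by blast
      also have "\<dots> \<le> \<epsilon> * ?C * \<rho> u * x"
        using w(2)[of u] u \<epsilon> C elim(2) by (intro mult_right_mono mult_left_mono) auto
      finally have err: "\<bar>smooth_count x y - ?C * x * \<rho> u\<bar> \<le> \<epsilon> * (?C * x * \<rho> u)"
        by (simp add: mult_ac)
      have main: "0 < ?C * x * \<rho> u" using C elim(2) dickman_pos[OF assms(1), of u] u by simp
      \<comment> \<open>The relative error itself; the division is legitimate because \<rho> is
        positive at \<open>u\<close>.\<close>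
      define \<delta> where "\<delta> = (smooth_count x y - ?C * x * \<rho> u) / (?C * x * \<rho> u)"
      have "\<bar>\<delta>\<bar> \<le> \<epsilon>" unfolding \<delta>_def abs_divide
        using err main by (simp only: abs_of_pos[OF main] pos_divide_le_eq[OF main])
      moreover have "\<delta> * (?C * x * \<rho> u) = smooth_count x y - ?C * x * \<rho> u"
        by (simp only: nonzero_eq_divide_eq[OF main[THEN less_imp_neq, symmetric], symmetric] \<delta>_def)
      then have "real (Psi_Gab x y) = (1 + \<delta>) * ?C * x * \<rho> u"
        by (simp add: Psi_Gab_eq_card_smooth_msets smooth_count_def algebra_simps)
      ultimately show "\<exists>\<delta>. \<bar>\<delta>\<bar> \<le> \<epsilon> \<and> real (Psi_Gab x y) = (1 + \<delta>) * ?C * x * \<rho> u" by blast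
    qed
  qed
qed

end
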